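(* Let $k\ge 2$, $n=n_1+\dots+n_k$, $m=m_1+\dots+m_k$, and let $A\in\mathbb{R}^{n\times n}$, $B\in\mathbb{R}^{n\times m}$, $Q\in\mathbb{R}^{n\times n}$, $R\in\mathbb{R}^{m\times m}$ all be block diagonal with respect to these partitions (the system is uncoupled), with $Q$ and $R$ symmetric positive definite. For fixed $B,Q,R$ let $P(A)$ denote the unique symmetric positive definite solution of the Riccati equation $PBR^{-1}B^TP-PA-A^TP-Q=0$ as a function of the (not necessarily block diagonal) matrix $A$, let $DP(A)$ be its derivative at the given block diagonal $A$, and let $A_{cl}=A-BR^{-1}B^TP(A)$. Then for every $\delta A\in\mathbb{R}^{n\times n}$ and all $i,j\in\{1,\dots,k\}$, $$ \left\|(DP(A)\cdot \delta A)_{i,j}\right\|_F \le \frac{\|P(A)_{i,i}\|_F+\|P(A)_{j,j}\|_F}{\mathrm{sep}\big((A_{cl})_{j,j},-(A_{cl})_{i,i}^T\big)}\max\big\{\|\delta A_{i,j}\|_F, \|\delta A_{j,i}\|_F\big\}. $$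
   Context: For $X\in\mathbb{R}^{n\times n}$, $X_{i,j}\in\mathbb{R}^{n_i\times n_j}$ denotes the $(i,j)$ block of $X$ with respect to the partition $n=n_1+\dots+n_k$; $B$ has diagonal blocks $B_{i,i}\in\mathbb{R}^{n_i\times m_i}$ and $R$ has diagonal blocks $R_{i,i}\in\mathbb{R}^{m_i\times m_i}$. $\|\cdot\|_F$ is the Frobenius norm. For square matrices $X,Y$, $\mathrm{sep}(X,Y)$ is the smallest singular value of $I\otimes X-Y^T\otimes I$, where $I$ denotes identity matrices of the appropriate sizes and $\otimes$ is the Kronecker product. The setting is the linear quadratic regulator problem $\dot x=Ax+Bu$ with cost $\int_0^\infty x^TQx+u^TRu\,dt$. Standing assumption: the Riccati equation has a unique symmetric positive definite solution for the given $A$ and for all matrices in a neighborhood of it, so that $P(\cdot)$ is defined there (it is real-analytic in an appropriate neighborhood of $A$); $u(x)=-R^{-1}B^TP(A)x$ is the optimal feedback and $A_{cl}$ is the closed-loop system matrix. *)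

theory Defs
  imports "HOL-Analysis.Analysis" "Jordan_Normal_Form.Char_Poly"
begin

no_notation Matrix.vec_index (infixl \<open>$\<close> 100)

text \<open>
  Full-size matrices are of type \<^typ>\<open>real ^ 'c ^ 'r\<close> (rows indexed by \<^typ>\<open>'r\<close>), so that
  Frechet derivatives are those of the analysis library. Blocks have sizes that depend on the
  block index, so they are matrices of type \<^typ>\<open>real mat\<close>, whose dimensions are numbers.
\<close>

text \<open>
  A partition into \<open>k\<close> blocks, numbered \<open>1\<close> to \<open>k\<close>: block \<open>i\<close> has \<open>bsize p i\<close> indices, and
  \<open>bidx p i a\<close> is the index at position \<open>a < bsize p i\<close> of block \<open>i\<close>. The bijection forces
  the sizes to sum up to the number of indices.
\<close>

record 'a bpart =
  bsize :: "nat \<Rightarrow> nat"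
  bidx :: "nat \<Rightarrow> nat \<Rightarrow> 'a"

definition partition_into :: "nat \<Rightarrow> 'a bpart \<Rightarrow> bool" where
  "partition_into k p \<longleftrightarrow>
     bij_betw (\<lambda>(i, a). bidx p i a) (SIGMA i:{1..k}. {..<bsize p i}) UNIV"

definition block ::
    "'r bpart \<Rightarrow> 'c bpart \<Rightarrow> real ^ 'c ^ 'r \<Rightarrow> nat \<Rightarrow> nat \<Rightarrow> real mat" where
  "block p q X i j =
     Matrix.mat (bsize p i) (bsize q j) (\<lambda>(a, b). X $ bidx p i a $ bidx q j b)"

definition block_diagonal ::
    "nat \<Rightarrow> 'r bpart \<Rightarrow> 'c bpart \<Rightarrow> real ^ 'c ^ 'r \<Rightarrow> bool" where
  "block_diagonal k p q X \<longleftrightarrow>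
     (\<forall>i\<in>{1..k}. \<forall>j\<in>{1..k}. i \<noteq> j \<longrightarrow> block p q X i j = 0\<^sub>m (bsize p i) (bsize q j))"

definition frob_norm :: "real mat \<Rightarrow> real" where
  "frob_norm M = sqrt (\<Sum>i<dim_row M. \<Sum>j<dim_col M. (M $$ (i, j))\<^sup>2)"

definition kronecker :: "real mat \<Rightarrow> real mat \<Rightarrow> real mat" where
  "kronecker M N =
     Matrix.mat (dim_row M * dim_row N) (dim_col M * dim_col N)
       (\<lambda>(i, j). M $$ (i div dim_row N, j div dim_col N) * N $$ (i mod dim_row N, j mod dim_col N))"

text \<open>
  For a square matrix the singular values are all the nonnegative square roots of eigenvalues of
  \<open>transpose M * M\<close>; for a matrix with more columns than rows this set could contain a
  superfluous \<open>0\<close>. Only square matrices are used here.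
\<close>

definition singular_values :: "real mat \<Rightarrow> real set" where
  "singular_values M = {s. 0 \<le> s \<and> eigenvalue (transpose_mat M * M) (s\<^sup>2)}"

definition sep :: "real mat \<Rightarrow> real mat \<Rightarrow> real" where
  "sep X Y =
     Min (singular_values
       (kronecker (1\<^sub>m (dim_row Y)) X - kronecker (transpose_mat Y) (1\<^sub>m (dim_row X))))"

definition sym_pos_def :: "real ^ 'n ^ 'n \<Rightarrow> bool" where
  "sym_pos_def M \<longleftrightarrow> Finite_Cartesian_Product.transpose M = M \<and> (\<forall>x. x \<noteq> 0 \<longrightarrow> 0 < x \<bullet> (M *v x))"

definition riccati ::
    "real ^ 'm ^ 'n \<Rightarrow> real ^ 'n ^ 'n \<Rightarrow> real ^ 'm ^ 'm \<Rightarrow> real ^ 'n ^ 'n \<Rightarrow> real ^ 'n ^ 'n \<Rightarrow> bool" where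
  "riccati B Q R A P \<longleftrightarrow>
     P ** B ** matrix_inv R ** Finite_Cartesian_Product.transpose B ** P
       - P ** A - Finite_Cartesian_Product.transpose A ** P - Q = 0"

definition riccati_sol ::
    "real ^ 'm ^ 'n \<Rightarrow> real ^ 'n ^ 'n \<Rightarrow> real ^ 'm ^ 'm \<Rightarrow> real ^ 'n ^ 'n \<Rightarrow> real ^ 'n ^ 'n" where
  "riccati_sol B Q R A = (THE P. sym_pos_def P \<and> riccati B Q R A P)"

definition closed_loop ::
    "real ^ 'm ^ 'n \<Rightarrow> real ^ 'n ^ 'n \<Rightarrow> real ^ 'm ^ 'm \<Rightarrow> real ^ 'n ^ 'n \<Rightarrow> real ^ 'n ^ 'n" where
  "closed_loop B Q R A =
     A - B ** matrix_inv R ** Finite_Cartesian_Product.transpose B ** riccati_sol B Q R A"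

end

theory Submission
  imports Defs
begin

no_notation Matrix.scalar_prod (infix \<open>\<bullet>\<close> 70)
hide_const (open) Matrix.mat List.transpose

text \<open>
  Let \<open>P\<close> be the Riccati solution at \<open>A\<close> and \<open>F\<close> the closed-loop matrix. Differentiating the Riccati
  equation in the direction \<open>H\<close> shows that the derivative \<open>D H\<close> of the solution satisfies the
  Lyapunov equation \<open>D H F + F\<^sup>T D H = - (P H + H\<^sup>T P)\<close>. If \<open>P\<close> and \<open>F\<close> are block diagonal, this
  equation decouples into one Sylvester equation for each block \<open>(i, j)\<close>, with right-hand side
  \<open>- (P\<^sub>i\<^sub>i H\<^sub>i\<^sub>j + (H\<^sub>j\<^sub>i)\<^sup>T P\<^sub>j\<^sub>j)\<close>. The separation is the smallest singular value of the Sylvester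
  operator on that block, and the estimate follows because the Frobenius norm is submultiplicative.

  Three facts have to be supplied. First, the Lyapunov operator of \<open>F\<close> is injective on all
  matrices (\<open>lyapunov_closed_loop_injective\<close>): the Riccati equation makes \<open>P\<close> a strict Lyapunov
  function of \<open>F\<close>, and a bilinear form that is constant along a flow with a strict quadratic Lyapunov
  function is zero. This makes the separation positive. It also yields the differentiability
  (\<open>riccati_sol_has_derivative\<close>): the inverse function theorem provides a differentiable branch of
  solutions, which stays symmetric and positive definite near \<open>A\<close> and hence is the Riccati solution,
  by its uniqueness. Second, \<open>P\<close> is block diagonal (\<open>riccati_sol_commute_projection\<close>): flipping the
  signs of the coordinates in one block preserves \<open>A\<close>, \<open>B\<close>, \<open>Q\<close> and \<open>R\<close>, hence also the
  unique solution. Third, the separation bounds the Lyapunov operator from below on each block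
  (\<open>sep_block_bound\<close>): vectorisation turns the adjoint of the block operator into the Kronecker
  matrix in the definition of the separation, and the minimum of \<open>norm (L Z) / norm Z\<close> is attained
  at an eigenvector of \<open>L\<^sup>T L\<close>.

  All estimates take place in the Euclidean space of full-size matrices, where a block is cut out
  by coordinate projections on both sides.
\<close>

section \<open>Matrix algebra and the Frobenius inner product\<close>

lemma matrix_transpose_add: "transpose (X + Y) = transpose X + transpose (Y :: real ^ 'n ^ 'm)"
  by (simp add: transpose_def Finite_Cartesian_Product.vec_eq_iff)

lemma matrix_transpose_diff: "transpose (X - Y) = transpose X - transpose (Y :: real ^ 'n ^ 'm)"
  by (simp add: transpose_def Finite_Cartesian_Product.vec_eq_iff)

lemma bounded_bilinear_matrix_mult:
  "bounded_bilinear ((**) :: real ^ 'n ^ 'm \<Rightarrow> real ^ 'k ^ 'n \<Rightarrow> real ^ 'k ^ 'm)"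
  unfolding bilinear_conv_bounded_bilinear[symmetric] bilinear_def linear_iff
  by (auto simp: matrix_matrix_mult_def Finite_Cartesian_Product.vec_eq_iff sum.distrib sum_distrib_left algebra_simps)

interpretation matrix_mult: bounded_bilinear "(**) :: real ^ 'n ^ 'm \<Rightarrow> real ^ 'k ^ 'n \<Rightarrow> real ^ 'k ^ 'm"
  by (rule bounded_bilinear_matrix_mult)

lemma bounded_linear_transpose: "bounded_linear (transpose :: real ^ 'n ^ 'm \<Rightarrow> real ^ 'm ^ 'n)"
  unfolding linear_conv_bounded_linear[symmetric] linear_iff
  by (simp add: matrix_transpose_add transpose_scalar)

lemma matrix_transpose_zero: "transpose (0 :: real ^ 'n ^ 'm) = 0"
  by (rule linear_0[OF bounded_linear.linear[OF bounded_linear_transpose]])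

lemma inner_matrix_mult_left:
  fixes M :: "real ^ 'n ^ 'm" and X :: "real ^ 'k ^ 'n" and Y :: "real ^ 'k ^ 'm"
  shows "(M ** X) \<bullet> Y = X \<bullet> (transpose M ** Y)"
proof -
  have "(M ** X) \<bullet> Y = (\<Sum>i\<in>UNIV. \<Sum>j\<in>UNIV. \<Sum>l\<in>UNIV. M $ i $ l * X $ l $ j * Y $ i $ j)"
    by (simp add: inner_vec_def matrix_matrix_mult_def sum_distrib_right)
  also have "\<dots> = (\<Sum>i\<in>UNIV. \<Sum>l\<in>UNIV. \<Sum>j\<in>UNIV. M $ i $ l * X $ l $ j * Y $ i $ j)"
    by (intro sum.cong refl sum.swap)
  also have "\<dots> = (\<Sum>l\<in>UNIV. \<Sum>i\<in>UNIV. \<Sum>j\<in>UNIV. M $ i $ l * X $ l $ j * Y $ i $ j)"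
    by (rule sum.swap)
  also have "\<dots> = (\<Sum>l\<in>UNIV. \<Sum>j\<in>UNIV. \<Sum>i\<in>UNIV. M $ i $ l * X $ l $ j * Y $ i $ j)"
    by (intro sum.cong refl sum.swap)
  also have "\<dots> = X \<bullet> (transpose M ** Y)"
    by (simp add: inner_vec_def matrix_matrix_mult_def transpose_def sum_distrib_left ac_simps)
  finally show ?thesis .
qed

lemma inner_transpose: "transpose X \<bullet> transpose Y = X \<bullet> (Y :: real ^ 'n ^ 'm)"
  unfolding inner_vec_def transpose_def by (simp add: sum.swap[of _ "UNIV :: 'n set"])

lemma norm_transpose: "norm (transpose X) = norm (X :: real ^ 'n ^ 'm)"
  by (simp only: norm_eq_sqrt_inner inner_transpose)

lemma inner_matrix_mult_right:
  fixes M :: "real ^ 'k ^ 'n" and X :: "real ^ 'n ^ 'm" and Y :: "real ^ 'k ^ 'm"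
  shows "(X ** M) \<bullet> Y = X \<bullet> (Y ** transpose M)"
proof -
  have "(X ** M) \<bullet> Y = (transpose M ** transpose X) \<bullet> transpose Y"
    by (simp only: inner_transpose flip: matrix_transpose_mul)
  also have "\<dots> = transpose X \<bullet> transpose (Y ** transpose M)"
    by (simp only: inner_matrix_mult_left matrix_transpose_mul transpose_transpose)
  finally show ?thesis by (simp only: inner_transpose)
qed

lemma norm_matrix_vector_mult_le: "norm (M *v x) \<le> norm M * norm (x :: real ^ 'n)"
proof -
  have "norm (M *v x) = L2_set (\<lambda>i. norm (M $ i \<bullet> x)) UNIV"
    by (simp add: norm_vec_def matrix_vector_mul_component)
  also have "\<dots> \<le> L2_set (\<lambda>i. norm (M $ i) * norm x) UNIV"
    by (intro L2_set_mono) (auto simp: Cauchy_Schwarz_ineq2)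
  also have "\<dots> = norm M * norm x"
    by (simp add: norm_vec_def[of M] L2_set_left_distrib)
  finally show ?thesis .
qed

text \<open>
  The norm on \<^typ>\<open>real ^ 'n ^ 'm\<close> is the Euclidean norm of the vector of row norms, that is, the
  Frobenius norm. Its submultiplicativity is Cauchy-Schwarz, applied to each row of the product.
\<close>

lemma norm_matrix_mult_le:
  fixes X :: "real ^ 'n ^ 'm" and Y :: "real ^ 'k ^ 'n"
  shows "norm (X ** Y) \<le> norm X * norm Y"
proof -
  have row: "(X ** Y) $ i = transpose Y *v (X $ i)" for i
    by (simp add: Finite_Cartesian_Product.vec_eq_iff matrix_matrix_mult_def matrix_vector_mult_def transpose_def mult.commute
        del: transpose_matrix_vector)
  have "norm (X ** Y) = L2_set (\<lambda>i. norm (transpose Y *v (X $ i))) UNIV"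
    by (simp add: norm_vec_def[of "X ** Y"] row del: transpose_matrix_vector)
  also have "\<dots> \<le> L2_set (\<lambda>i. norm (X $ i) * norm Y) UNIV"
    by (intro L2_set_mono norm_ge_zero) (metis norm_matrix_vector_mult_le norm_transpose mult.commute)
  also have "\<dots> = norm X * norm Y"
    by (simp add: norm_vec_def[of X] L2_set_left_distrib)
  finally show ?thesis .
qed

lemma inner_matrix_vector_mult: "x \<bullet> (M *v y) = (transpose M *v x) \<bullet> (y :: real ^ 'n)"
  for M :: "real ^ 'n ^ 'm"
  by (simp add: dot_lmul_matrix)

section \<open>Injectivity of the Lyapunov operator\<close>

text \<open>
  The quadratic function \<open>w \<bullet> T w\<close> has a minimum at \<open>v\<close>, so its derivative, which is proportional to
  \<open>T v\<close>, vanishes there. This is how extremal values of a ratio of quadratic forms are turned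
  into eigenvector equations, here and in the treatment of singular values.
\<close>

lemma semidefinite_null_vector:
  fixes T :: "'a::real_inner \<Rightarrow> 'a"
  assumes lin: "linear T" and sym: "\<And>v w. T v \<bullet> w = v \<bullet> T w"
    and psd: "\<And>w. 0 \<le> w \<bullet> T w" and null: "v \<bullet> T v = 0"
  shows "T v = 0"
proof -
  define a b where "a = T v \<bullet> T v" and "b = T v \<bullet> T (T v)"
  have *: "0 \<le> t\<^sup>2 * b - 2 * t * a" for t
  proof -
    have "0 \<le> (v - t *\<^sub>R T v) \<bullet> T (v - t *\<^sub>R T v)" by (rule psd)
    also have "\<dots> = t\<^sup>2 * b - 2 * t * a"
      using null sym[of v "T v"]
      by (simp add: a_def b_def linear_diff[OF lin] linear_scale[OF lin] inner_diff_left
          inner_diff_right power2_eq_square algebra_simps inner_commute)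
    finally show ?thesis .
  qed
  have "a = 0"
  proof (rule ccontr)
    assume "a \<noteq> 0"
    hence a: "a > 0" by (simp add: a_def)
    have b: "b \<ge> 0" unfolding b_def by (rule psd)
    \<comment> \<open>The minimum over \<open>t\<close> is at \<open>a / b\<close>; adding \<open>1\<close> covers \<open>b = 0\<close>.\<close>
    define t where "t = a / (b + 1)"
    have t: "t > 0" "t * b = a - t"
      using a b by (simp_all add: t_def field_simps)
    have "0 \<le> t\<^sup>2 * b - 2 * t * a" by (rule *)
    also have "\<dots> = - (t * (a + t))"
      using t(2) by (simp add: power2_eq_square mult.assoc) (simp add: algebra_simps)
    also have "\<dots> < 0"
      using a t(1) by simp
    finally show False by simp
  qed
  thus ?thesis by (simp add: a_def)
qed

text \<open>
  Along \<open>w' = F w\<close> the form \<open>w \<bullet> P w\<close> strictly decreases while \<open>w \<bullet> X w\<close> is constant. At a maximiser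
  \<open>v\<close> of the ratio of the two forms the gradients are proportional, \<open>X v = l P v\<close>, hence so are the
  derivatives of the forms along the flow. One of these is zero and the other is not, which
  forces the maximal ratio \<open>l\<close> to be zero.
\<close>

lemma lyapunov_form_nonpos:
  fixes F P X :: "'a::euclidean_space \<Rightarrow> 'a"
  assumes linF: "linear F" and linP: "linear P" and linX: "linear X"
    and symP: "\<And>v w. P v \<bullet> w = v \<bullet> P w" and symX: "\<And>v w. X v \<bullet> w = v \<bullet> X w"
    and posP: "\<And>w. w \<noteq> 0 \<Longrightarrow> 0 < w \<bullet> P w"
    and decr: "\<And>w. w \<noteq> 0 \<Longrightarrow> w \<bullet> P (F w) < 0"
    and const: "\<And>w. w \<bullet> X (F w) = 0"
  shows "w \<bullet> X w \<le> 0"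
proof -
  have cont: "continuous_on (sphere 0 1) (\<lambda>w. (w \<bullet> X w) / (w \<bullet> P w))"
  proof -
    have "continuous_on (sphere 0 1) X" "continuous_on (sphere 0 1) P"
      using linX linP by (simp_all add: linear_continuous_on linear_conv_bounded_linear)
    moreover have "w \<bullet> P w \<noteq> 0" if "w \<in> sphere 0 1" for w
    proof -
      have "w \<noteq> 0" using that by auto
      thus ?thesis using posP[of w] by simp
    qed
    ultimately show ?thesis by (intro continuous_intros) auto
  qed
  have "sphere (0::'a) 1 \<noteq> {}"
    by (metis SOME_Basis norm_Basis dist_0_norm empty_iff mem_sphere)
  then obtain v where v: "norm v = 1"
    and max: "\<And>w. norm w = 1 \<Longrightarrow> (w \<bullet> X w) / (w \<bullet> P w) \<le> (v \<bullet> X v) / (v \<bullet> P v)"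
    using continuous_attains_sup[OF compact_sphere _ cont] by auto
  define l where "l = (v \<bullet> X v) / (v \<bullet> P v)"
  have v0: "v \<noteq> 0" using v by auto
  have le: "w \<bullet> X w \<le> l * (w \<bullet> P w)" for w
  proof (cases "w = 0")
    case False
    define u where "u = w /\<^sub>R norm w"
    have "norm u = 1" using False by (simp add: u_def)
    from max[OF this] have "u \<bullet> X u \<le> l * (u \<bullet> P u)"
      using posP[of u] \<open>norm u = 1\<close>
      by (metis l_def norm_zero pos_divide_le_eq zero_neq_one)
    moreover have wu: "w = norm w *\<^sub>R u" using False by (simp add: u_def)
    have "(r *\<^sub>R u) \<bullet> X (r *\<^sub>R u) = r\<^sup>2 * (u \<bullet> X u)"
      "(r *\<^sub>R u) \<bullet> P (r *\<^sub>R u) = r\<^sup>2 * (u \<bullet> P u)" for r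
      by (simp_all add: linear_scale[OF linX] linear_scale[OF linP] power2_eq_square)
    from this[of "norm w"] have "w \<bullet> X w = (norm w)\<^sup>2 * (u \<bullet> X u)"
      and "w \<bullet> P w = (norm w)\<^sup>2 * (u \<bullet> P u)"
      by (simp_all only: wu[symmetric])
    ultimately show ?thesis
      using mult_left_mono[of "u \<bullet> X u" "l * (u \<bullet> P u)" "(norm w)\<^sup>2"]
      by (simp add: algebra_simps)
  qed (simp add: linear_0[OF linX] linear_0[OF linP])
  define T where "T = (\<lambda>w. l *\<^sub>R P w - X w)"
  have "T v = 0"
  proof (rule semidefinite_null_vector[where T = T and v = v])
    show "linear T" unfolding T_def
      by (intro linear_compose_sub linear_compose_scale_right linX linP)
    show "T u \<bullet> w = u \<bullet> T w" for u w
      by (simp add: T_def inner_diff_left inner_diff_right symP symX)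
    show "0 \<le> w \<bullet> T w" for w
      using le by (simp add: T_def inner_diff_right)
    show "v \<bullet> T v = 0"
      using posP[OF v0] by (simp add: T_def inner_diff_right l_def)
  qed
  hence "X v = l *\<^sub>R P v" by (simp add: T_def)
  hence "l * (v \<bullet> P (F v)) = 0"
    using const[of v] by (metis inner_scaleR_left symP symX)
  hence "l = 0" using decr[OF v0] by simp
  thus ?thesis using le[of w] by simp
qed

text \<open>
  For a symmetric \<open>X\<close> the preceding lemma applies to \<open>X\<close> and \<open>-X\<close>. In general \<open>X\<close> need not be
  symmetric, and it is the bilinear form \<open>u \<bullet> X v\<close> that is constant along the flow. This form is a
  quadratic form of the pair \<open>(u, v)\<close>, belonging to the self-adjoint map \<open>(u, v) \<mapsto> (X v, X\<^sup>T u)\<close>,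
  while \<open>P\<close> and \<open>F\<close> act on both components. Doubling the space thus reduces the claim to the
  symmetric case. The bound \<open>u \<bullet> X v \<le> 0\<close> for all \<open>u\<close>, and in particular for \<open>u = X v\<close>, gives \<open>X v = 0\<close>.
\<close>

lemma lyapunov_operator_injective:
  fixes F P X :: "real ^ 'n ^ 'n"
  assumes P: "sym_pos_def P"
    and decr: "\<And>x. x \<noteq> 0 \<Longrightarrow> x \<bullet> ((P ** F + transpose F ** P) *v x) < 0"
    and X: "X ** F + transpose F ** X = 0"
  shows "X = 0"
proof -
  have symP: "transpose P = P" and posP: "\<And>x. x \<noteq> 0 \<Longrightarrow> 0 < x \<bullet> (P *v x)"
    using P by (auto simp: sym_pos_def_def)
  have decr': "x \<bullet> (P *v (F *v x)) < 0" if "x \<noteq> 0" for x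
  proof -
    have "x \<bullet> ((transpose F ** P) *v x) = x \<bullet> (P *v (F *v x))"
      using symP inner_matrix_vector_mult[of x "transpose F" "P *v x"]
        inner_matrix_vector_mult[of "F *v x" P x]
      by (simp add: inner_commute flip: matrix_vector_mul_assoc del: transpose_matrix_vector)
    with decr[OF that] show ?thesis
      by (simp add: matrix_vector_mult_add_rdistrib inner_add_right flip: matrix_vector_mul_assoc)
  qed
  let ?F = "\<lambda>(u, v). (F *v u, F *v v)" and ?P = "\<lambda>(u, v). (P *v u, P *v v)"
    and ?X = "\<lambda>(u, v). (X *v v, transpose X *v u)"
  have form: "w \<bullet> ?X w \<le> 0" for w
  proof (rule lyapunov_form_nonpos[of ?F ?P ?X])
    show "linear ?F" "linear ?P" "linear ?X"
      by (auto simp: linear_iff split_beta matrix_vector_right_distrib matrix_vector_mult_scaleR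
          simp del: transpose_matrix_vector)
    show "?P v \<bullet> w = v \<bullet> ?P w" for v w
      by (auto simp: split_beta inner_prod_def inner_matrix_vector_mult symP simp del: transpose_matrix_vector)
    show "?X v \<bullet> w = v \<bullet> ?X w" for v w
      by (auto simp: split_beta inner_prod_def inner_matrix_vector_mult simp del: transpose_matrix_vector)
    have nonneg: "0 \<le> x \<bullet> (P *v x)" and nonpos: "x \<bullet> (P *v (F *v x)) \<le> 0" for x
      using posP[of x] decr'[of x] by (cases "x = 0"; simp)+
    show "0 < w \<bullet> ?P w" if "w \<noteq> 0" for w
    proof -
      obtain u v where w: "w = (u, v)" by force
      hence "u \<noteq> 0 \<or> v \<noteq> 0" using that by (auto simp: zero_prod_def)
      thus ?thesis
        using posP[of u] posP[of v] nonneg[of u] nonneg[of v] by (auto simp: w inner_prod_def)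
    qed
    show "w \<bullet> ?P (?F w) < 0" if "w \<noteq> 0" for w
    proof -
      obtain u v where w: "w = (u, v)" by force
      hence "u \<noteq> 0 \<or> v \<noteq> 0" using that by (auto simp: zero_prod_def)
      thus ?thesis
        using decr'[of u] decr'[of v] nonpos[of u] nonpos[of v] by (auto simp: w inner_prod_def)
    qed
    show "w \<bullet> ?X (?F w) = 0" for w
    proof -
      obtain u v where w: "w = (u, v)" by force
      have "w \<bullet> ?X (?F w) = u \<bullet> ((X ** F) *v v) + v \<bullet> (transpose X *v (F *v u))"
        by (simp add: w inner_prod_def matrix_vector_mul_assoc del: transpose_matrix_vector)
      also have "v \<bullet> (transpose X *v (F *v u)) = u \<bullet> ((transpose F ** X) *v v)"
        using inner_matrix_vector_mult[of v "transpose X" "F *v u"]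
          inner_matrix_vector_mult[of u "transpose F" "X *v v"]
        by (simp add: inner_commute flip: matrix_vector_mul_assoc del: transpose_matrix_vector)
      also have "u \<bullet> ((X ** F) *v v) + u \<bullet> ((transpose F ** X) *v v) = 0"
        by (metis X inner_add_right inner_zero_right matrix_vector_mult_0 matrix_vector_mult_add_rdistrib)
      finally show ?thesis .
    qed
  qed
  have "X *v v = 0" for v
  proof -
    have "(X *v v) \<bullet> (X *v v) \<le> 0"
      using form[of "(X *v v, v)"] inner_matrix_vector_mult[of v "transpose X" "X *v v"]
      by (simp add: inner_prod_def inner_commute del: transpose_matrix_vector)
    thus ?thesis by (metis inner_gt_zero_iff not_less)
  qed
  thus ?thesis by (metis matrix_eq matrix_vector_mult_0)
qed

section \<open>The Riccati equation and its Lyapunov operator\<close>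

lemma sym_pos_def_invertible: "sym_pos_def M \<Longrightarrow> invertible M"
  unfolding invertible_left_inverse matrix_left_invertible_ker sym_pos_def_def
  by (metis inner_zero_right less_irrefl)

lemma matrix_inv_inverse:
  assumes "invertible M"
  shows "M ** matrix_inv M = mat 1" "matrix_inv M ** M = mat 1"
  using someI_ex[OF assms[unfolded invertible_def]] by (simp_all add: matrix_inv_def)

lemma matrix_inv_eqI:
  assumes M: "invertible M" and "X ** M = mat 1"
  shows "X = matrix_inv M"
  by (metis assms(2) matrix_inv_inverse(1)[OF M] matrix_mul_assoc matrix_mul_lid matrix_mul_rid)

lemma transpose_matrix_inv:
  fixes M :: "real ^ 'n ^ 'n"
  assumes M: "invertible M" and sym: "transpose M = M"
  shows "transpose (matrix_inv M) = matrix_inv M"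
proof (rule matrix_inv_eqI[OF M])
  have "transpose (matrix_inv M) ** transpose M = transpose (M ** matrix_inv M)"
    by (simp only: matrix_transpose_mul)
  thus "transpose (matrix_inv M) ** M = mat 1"
    by (simp only: sym matrix_inv_inverse[OF M] transpose_mat)
qed

text \<open>
  The coefficient of the quadratic term of the Riccati equation. The input data \<open>B\<close> and \<open>R\<close> enter
  the Riccati equation and the closed-loop matrix only through this symmetric positive
  semidefinite matrix.
\<close>

definition riccati_coeff :: "real ^ 'm ^ 'n \<Rightarrow> real ^ 'm ^ 'm \<Rightarrow> real ^ 'n ^ 'n" where
  "riccati_coeff B R = B ** matrix_inv R ** transpose B"

lemma transpose_riccati_coeff:
  assumes "sym_pos_def R"
  shows "transpose (riccati_coeff B R) = riccati_coeff B R"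
  using transpose_matrix_inv[of R] sym_pos_def_invertible[OF assms] assms
  by (simp only: riccati_coeff_def matrix_transpose_mul Finite_Cartesian_Product.transpose_transpose matrix_mul_assoc sym_pos_def_def)

lemma riccati_coeff_nonneg:
  assumes R: "sym_pos_def R"
  shows "0 \<le> x \<bullet> (riccati_coeff B R *v x)"
proof -
  let ?y = "matrix_inv R *v (transpose B *v x)"
  have inv: "R *v ?y = transpose B *v x"
    by (simp only: matrix_vector_mul_assoc matrix_mul_assoc matrix_inv_inverse[OF sym_pos_def_invertible[OF R]]
        matrix_mul_lid)
  have "x \<bullet> (riccati_coeff B R *v x) = x \<bullet> (B *v ?y)"
    by (simp only: riccati_coeff_def matrix_vector_mul_assoc matrix_mul_assoc)
  also have "\<dots> = (transpose B *v x) \<bullet> ?y"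
    by (rule inner_matrix_vector_mult)
  also have "\<dots> = ?y \<bullet> (R *v ?y)"
    by (simp only: inv inner_commute)
  also have "\<dots> \<ge> 0"
    using R unfolding sym_pos_def_def by (cases "?y = 0") (auto intro: less_imp_le simp del: transpose_matrix_vector)
  finally show ?thesis .
qed

definition lyapunov :: "real ^ 'n ^ 'n \<Rightarrow> real ^ 'n ^ 'n \<Rightarrow> real ^ 'n ^ 'n" where
  "lyapunov F X = X ** F + transpose F ** X"

definition riccati_residual ::
    "real ^ 'n ^ 'n \<Rightarrow> real ^ 'n ^ 'n \<Rightarrow> real ^ 'n ^ 'n \<Rightarrow> real ^ 'n ^ 'n \<Rightarrow> real ^ 'n ^ 'n" where
  "riccati_residual S Q A P = P ** S ** P - P ** A - transpose A ** P - Q"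

lemma riccati_iff_residual: "riccati B Q R A P \<longleftrightarrow> riccati_residual (riccati_coeff B R) Q A P = 0"
  by (simp only: riccati_def riccati_residual_def riccati_coeff_def matrix_mul_assoc)

text \<open>
  Rewriting the Riccati equation with the closed-loop matrix \<open>F = A - S P\<close> gives
  \<open>P F + F\<^sup>T P = - (Q + P S P)\<close>: the solution of the Riccati equation is a Lyapunov function of the
  closed loop.
\<close>

lemma riccati_lyapunov_negative:
  assumes S: "transpose S = S" "\<And>x. 0 \<le> x \<bullet> (S *v x)" and Q: "sym_pos_def Q" and P: "transpose P = P"
    and ric: "riccati_residual S Q A P = 0" and "x \<noteq> 0"
  shows "x \<bullet> (lyapunov (A - S ** P) P *v x) < 0"
proof -
  have "lyapunov (A - S ** P) P = - (Q + P ** S ** P) - riccati_residual S Q A P"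
    unfolding lyapunov_def riccati_residual_def
    by (simp add: matrix_transpose_diff matrix_transpose_mul S P matrix_mult.diff_left matrix_mult.diff_right matrix_mul_assoc)
  hence "lyapunov (A - S ** P) P + (Q + P ** S ** P) = 0"
    by (simp add: ric)
  from arg_cong[OF this, of "\<lambda>M. x \<bullet> (M *v x)"]
  have "x \<bullet> (lyapunov (A - S ** P) P *v x) + (x \<bullet> (Q *v x) + x \<bullet> ((P ** S ** P) *v x)) = 0"
    by (simp add: matrix_vector_mult_add_rdistrib inner_add_right)
  moreover have "x \<bullet> ((P ** S ** P) *v x) = (P *v x) \<bullet> (S *v (P *v x))"
    using inner_matrix_vector_mult[of x P "S *v (P *v x)"]
    by (simp only: P matrix_vector_mul_assoc matrix_mul_assoc)
  ultimately show ?thesis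
    using S(2)[of "P *v x"] Q \<open>x \<noteq> 0\<close> unfolding sym_pos_def_def by (smt (verit))
qed

lemma lyapunov_closed_loop_injective:
  assumes S: "transpose S = S" "\<And>x. 0 \<le> x \<bullet> (S *v x)" and Q: "sym_pos_def Q" and P: "sym_pos_def P"
    and ric: "riccati_residual S Q A P = 0" and X: "lyapunov (A - S ** P) X = 0"
  shows "X = 0"
  using lyapunov_operator_injective[OF P, of "A - S ** P" X]
    riccati_lyapunov_negative[OF S Q _ ric] P X
  unfolding lyapunov_def sym_pos_def_def by blast

section \<open>Differentiability of the Riccati solution\<close>

text \<open>
  The form \<open>x \<bullet> P x\<close> is bounded below by some \<open>c > 0\<close> on the unit sphere, and changing \<open>P\<close> by less than
  \<open>c\<close> in norm cannot destroy its positivity.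
\<close>

lemma eventually_pos_def:
  fixes P :: "real ^ 'n ^ 'n"
  assumes pos: "\<And>x. x \<noteq> 0 \<Longrightarrow> 0 < x \<bullet> (P *v x)"
  shows "\<forall>\<^sub>F X in nhds P. \<forall>x. x \<noteq> 0 \<longrightarrow> 0 < x \<bullet> (X *v x)"
proof -
  have "continuous_on (sphere 0 1) (\<lambda>x. x \<bullet> (P *v x))"
    by (intro continuous_intros linear_continuous_on matrix_vector_mul_bounded_linear)
  moreover have "sphere (0::real ^ 'n) 1 \<noteq> {}"
    by (metis SOME_Basis norm_Basis dist_0_norm empty_iff mem_sphere)
  ultimately obtain v where v: "norm v = 1" and
    min: "\<And>x. norm x = 1 \<Longrightarrow> v \<bullet> (P *v v) \<le> x \<bullet> (P *v x)"
    using continuous_attains_inf[OF compact_sphere, of 0 1 "\<lambda>x. x \<bullet> (P *v x)"] by auto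
  define c where "c = v \<bullet> (P *v v)"
  have "0 < c" using pos[of v] v by (cases "v = 0") (auto simp: c_def)
  have "0 < x \<bullet> (X *v x)" if X: "dist X P < c" and "x \<noteq> 0" for X x
  proof -
    define u where "u = x /\<^sub>R norm x"
    have u: "norm u = 1" "x = norm x *\<^sub>R u" using \<open>x \<noteq> 0\<close> by (auto simp: u_def)
    have "\<bar>u \<bullet> ((X - P) *v u)\<bar> \<le> norm u * norm ((X - P) *v u)"
      by (rule Cauchy_Schwarz_ineq2)
    also have "\<dots> \<le> norm (X - P)"
      using norm_matrix_vector_mult_le[of "X - P" u] u by simp
    also have "\<dots> < c" using X by (simp add: dist_norm)
    finally have "0 < u \<bullet> (X *v u)"
      using min[OF u(1)] by (simp add: c_def matrix_vector_mult_diff_rdistrib inner_diff_right)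
    hence "0 < norm x * (norm x * (u \<bullet> (X *v u)))"
      using \<open>x \<noteq> 0\<close> by simp
    also have "\<dots> = (norm x *\<^sub>R u) \<bullet> (X *v (norm x *\<^sub>R u))"
      by (simp add: matrix_vector_mult_scaleR)
    also have "\<dots> = x \<bullet> (X *v x)"
      by (simp only: u(2)[symmetric])
    finally show ?thesis .
  qed
  thus ?thesis using \<open>0 < c\<close> unfolding eventually_nhds_metric by blast
qed

text \<open>
  For symmetric \<open>S\<close> and a symmetric value of \<open>g\<close> the two factors around \<open>g' h\<close> are the closed-loop matrix
  and its transpose. The general form serves to obtain the derivative of the
  residual at all points, as the inverse function theorem demands.
\<close>

lemma riccati_residual_has_derivative:
  assumes "(f has_derivative f') (at x)" "(g has_derivative g') (at x)"
  shows "((\<lambda>x. riccati_residual S Q (f x) (g x)) has_derivative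
    (\<lambda>h. - (g x ** f' h + transpose (f' h) ** g x)
      - (g' h ** (f x - S ** g x) + (transpose (f x) - g x ** S) ** g' h))) (at x)"
  unfolding riccati_residual_def
  by (auto intro!: derivative_eq_intros assms matrix_mult.FDERIV
      bounded_linear.has_derivative[OF bounded_linear_transpose]
      simp: fun_eq_iff matrix_mult.diff_left matrix_mult.diff_right matrix_mul_assoc algebra_simps)

text \<open>
  The inverse function theorem is applied to \<open>(X, Y) \<mapsto> (X, residual of Y for X)\<close> at \<open>(A, P)\<close>. The
  derivative of the residual in the direction of \<open>Y\<close> is minus the Lyapunov operator of the closed
  loop, which is injective, so there is a differentiable branch \<open>p\<close> of solutions with \<open>p A = P\<close>.
  Near \<open>A\<close> the matrix \<open>p X\<close> is symmetric, because its transpose is a solution close to \<open>P\<close> too and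
  the branch is locally unique; it is positive definite because \<open>P\<close> is. By the uniqueness
  hypothesis \<open>p X\<close> is the Riccati solution of \<open>X\<close>. Differentiating the Riccati equation
  along \<open>p\<close> then gives a Lyapunov equation for the derivative.
\<close>

theorem riccati_sol_has_derivative:
  fixes A :: "real ^ 'n ^ 'n" and B :: "real ^ 'm ^ 'n"
  assumes Q: "sym_pos_def Q" and R: "sym_pos_def R"
    and uniq: "\<forall>\<^sub>F X in nhds A. \<exists>!P. sym_pos_def P \<and> riccati B Q R X P"
  defines "P \<equiv> riccati_sol B Q R A" and "F \<equiv> closed_loop B Q R A"
  obtains D where "(riccati_sol B Q R has_derivative D) (at A)"
    and "\<And>H. lyapunov F (D H) = - (P ** H + transpose H ** P)"
proof -
  define S where "S = riccati_coeff B R"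
  let ?ric = "riccati_residual S Q"
  have S: "transpose S = S" "\<And>x. 0 \<le> x \<bullet> (S *v x)"
    using transpose_riccati_coeff[OF R] riccati_coeff_nonneg[OF R] by (auto simp: S_def)
  have riccati: "riccati B Q R X Y \<longleftrightarrow> ?ric X Y = 0" for X Y
    by (simp add: riccati_iff_residual S_def)
  have sol_eq: "riccati_sol B Q R X = Y"
    if "\<exists>!P. sym_pos_def P \<and> riccati B Q R X P" "sym_pos_def Y" "?ric X Y = 0" for X Y
    using that unfolding riccati_sol_def by (intro the1_equality) (auto simp: riccati)
  have uniqA: "\<exists>!P. sym_pos_def P \<and> riccati B Q R A P"
    using uniq by (rule eventually_nhds_x_imp_x)
  have P: "sym_pos_def P" "?ric A P = 0"
    using theI'[OF uniqA] by (simp_all add: P_def riccati_sol_def riccati)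
  have symP: "transpose P = P" using P by (simp add: sym_pos_def_def)
  have F: "F = A - S ** P"
    by (simp only: F_def closed_loop_def S_def riccati_coeff_def P_def)
  have F': "transpose F = transpose A - P ** S"
    by (simp only: F matrix_transpose_diff matrix_transpose_mul S symP)
  define \<Phi> where "\<Phi> = (\<lambda>(X, Y). (X, ?ric X Y))"
  define \<Phi>' where "\<Phi>' = (\<lambda>(X, Y) (H, K). (H, - (Y ** H + transpose H ** Y)
      - (K ** (X - S ** Y) + (transpose X - Y ** S) ** K)))"
  have der: "(\<Phi> has_derivative \<Phi>' z) (at z)" for z
  proof -
    have "((\<lambda>z. (fst z, ?ric (fst z) (snd z))) has_derivative
      (\<lambda>h. (fst h, - (snd z ** fst h + transpose (fst h) ** snd z)
      - (snd h ** (fst z - S ** snd z) + (transpose (fst z) - snd z ** S) ** snd h)))) (at z)"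
      by (intro has_derivative_Pair riccati_residual_has_derivative has_derivative_fst has_derivative_snd has_derivative_ident)
    thus ?thesis by (simp add: \<Phi>_def \<Phi>'_def split_beta')
  qed
  have blin: "bounded_linear (\<Phi>' z)" for z
    using der by (rule has_derivative_bounded_linear)
  have cont: "continuous_on UNIV (\<lambda>z. Blinfun (\<Phi>' z))"
  proof (rule continuous_on_blinfun_componentwise)
    fix i :: "(real ^ 'n ^ 'n) \<times> (real ^ 'n ^ 'n)"
    have "continuous_on UNIV (\<lambda>z :: (real ^ 'n ^ 'n) \<times> (real ^ 'n ^ 'n). transpose (fst z))"
      by (rule bounded_linear.continuous_on[OF bounded_linear_transpose]) (intro continuous_intros)
    hence "continuous_on UNIV (\<lambda>z. \<Phi>' z i)"
      unfolding \<Phi>'_def split_beta' by (intro continuous_intros matrix_mult.continuous_on)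
    thus "continuous_on UNIV (\<lambda>z. blinfun_apply (Blinfun (\<Phi>' z)) i)"
      by (simp only: bounded_linear_Blinfun_apply[OF blin])
  qed
  have "inj (\<Phi>' (A, P))"
  proof (subst linear_injective_0)
    show "linear (\<Phi>' (A, P))" using blin by (simp add: linear_conv_bounded_linear)
    show "\<forall>h. \<Phi>' (A, P) h = 0 \<longrightarrow> h = 0"
    proof (intro allI impI)
      fix h assume *: "\<Phi>' (A, P) h = 0"
      obtain H K where h: "h = (H, K)" by force
      have "H = 0" using * by (simp add: h \<Phi>'_def zero_prod_def)
      moreover have "\<Phi>' (A, P) (0, K) = (0, - lyapunov (A - S ** P) K)"
        by (simp add: \<Phi>'_def lyapunov_def F'[unfolded F, symmetric] matrix_transpose_zero
            matrix_mult.zero_left matrix_mult.zero_right)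
      ultimately have "lyapunov (A - S ** P) K = 0"
        using * by (simp add: h zero_prod_def)
      with \<open>H = 0\<close> show "h = 0"
        using lyapunov_closed_loop_injective[OF S Q P] by (simp add: h zero_prod_def)
    qed
  qed
  then obtain \<Psi> where "linear \<Psi>" "\<Psi> \<circ> \<Phi>' (A, P) = id"
    using linear_injective_left_inverse[of "\<Phi>' (A, P)"] blin by (auto simp: linear_conv_bounded_linear)
  hence inv: "Blinfun \<Psi> o\<^sub>L Blinfun (\<Phi>' (A, P)) = id_blinfun"
    by (intro blinfun_eqI) (simp add: bounded_linear_Blinfun_apply blin linear_conv_bounded_linear pointfree_idE)
  have der': "(\<Phi> has_derivative blinfun_apply (Blinfun (\<Phi>' z))) (at z)" for z
    using der by (simp only: bounded_linear_Blinfun_apply[OF blin])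
  obtain U V g g' where U: "open U" "(A, P) \<in> U" and V: "open V" "\<Phi> (A, P) \<in> V"
    and hom: "homeomorphism U V \<Phi> g" and g': "\<And>y. y \<in> V \<Longrightarrow> (g has_derivative (g' y)) (at y)"
    by (rule inverse_function_theorem[OF open_UNIV der' cont UNIV_I inv]) blast
  have \<Phi>A: "\<Phi> (A, P) = (A, 0)" by (simp add: \<Phi>_def P)
  define p where "p X = snd (g (X, 0))" for X
  have pA: "p A = P"
    using homeomorphism_apply1[OF hom U(2)] by (simp add: p_def \<Phi>A)
  have emb: "((\<lambda>X. (X, 0 :: real ^ 'n ^ 'n)) has_derivative (\<lambda>H. (H, 0))) (at A)"
    by (intro has_derivative_Pair has_derivative_ident has_derivative_const)
  have "(g has_derivative g' (A, 0)) (at (A, 0))"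
    using V(2) by (intro g') (simp only: \<Phi>A)
  from has_derivative_compose[OF emb this]
  have "((\<lambda>X. g (X, 0)) has_derivative (\<lambda>H. g' (A, 0) (H, 0))) (at A)" .
  hence "(p has_derivative (\<lambda>H. snd (g' (A, 0) (H, 0)))) (at A)"
    unfolding p_def by (rule has_derivative_snd)
  then obtain D where D: "(p has_derivative D) (at A)" by blast
  have lim: "(p \<longlongrightarrow> P) (nhds A)"
    using has_derivative_continuous[OF D] by (simp add: isCont_def tendsto_at_iff_tendsto_nhds flip: pA)
  have "((\<lambda>X. (X, 0)) \<longlongrightarrow> (A, 0)) (nhds A)"
    by (intro tendsto_Pair tendsto_const filterlim_ident)
  hence evV: "\<forall>\<^sub>F X in nhds A. (X, 0) \<in> V"
    using V by (intro topological_tendstoD) (simp_all add: \<Phi>A)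
  have "((\<lambda>X. (X, transpose (p X))) \<longlongrightarrow> (A, transpose P)) (nhds A)"
    by (intro tendsto_Pair filterlim_ident bounded_linear.tendsto[OF bounded_linear_transpose] lim)
  hence evU: "\<forall>\<^sub>F X in nhds A. (X, transpose (p X)) \<in> U"
    using U by (intro topological_tendstoD) (simp_all add: symP)
  have evpos: "\<forall>\<^sub>F X in nhds A. \<forall>x. x \<noteq> 0 \<longrightarrow> 0 < x \<bullet> (p X *v x)"
    using P(1) by (intro eventually_compose_filterlim[OF eventually_pos_def lim]) (simp add: sym_pos_def_def)
  have ric_p: "?ric X (p X) = 0 \<and> (X, p X) \<in> U" if "(X, 0) \<in> V" for X
  proof -
    have "\<Phi> (g (X, 0)) = (X, 0)" "g (X, 0) \<in> U"
      using hom that by (auto simp: homeomorphism_def)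
    thus ?thesis by (cases "g (X, 0)") (auto simp: \<Phi>_def p_def)
  qed
  have sol: "\<forall>\<^sub>F X in nhds A. p X = riccati_sol B Q R X"
    using evV evU evpos uniq
  proof eventually_elim
    case (elim X)
    have "?ric X (transpose (p X)) = transpose (?ric X (p X))"
      by (simp add: riccati_residual_def matrix_transpose_diff matrix_transpose_mul S matrix_mul_assoc)
        (use Q in \<open>simp add: sym_pos_def_def\<close>)
    \<comment> \<open>Both points lie in \<open>U\<close>, where \<open>\<Phi>\<close> is injective.\<close>
    hence "\<Phi> (X, transpose (p X)) = \<Phi> (X, p X)"
      using ric_p[OF elim(1)] by (simp add: \<Phi>_def matrix_transpose_zero matrix_mult.zero_left matrix_mult.zero_right)
    hence "(X, transpose (p X)) = (X, p X)"
      using homeomorphism_apply1[OF hom elim(2)] homeomorphism_apply1[OF hom, of "(X, p X)"]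
        ric_p[OF elim(1)] by simp
    hence "transpose (p X) = p X" by simp
    hence "sym_pos_def (p X)"
      using elim(3) by (simp add: sym_pos_def_def)
    thus ?case using sol_eq[OF elim(4)] ric_p[OF elim(1)] by simp
  qed
  have "(riccati_sol B Q R has_derivative D) (at A)"
    by (rule has_derivative_transform_eventually[OF D filter_leD[OF at_within_le_nhds sol]
          eventually_nhds_x_imp_x[OF sol] UNIV_I])
  moreover have "lyapunov F (D H) = - (P ** H + transpose H ** P)" for H
  proof -
    have "((\<lambda>X. ?ric X (p X)) has_derivative (\<lambda>H. - (P ** H + transpose H ** P) - lyapunov F (D H))) (at A)"
      using riccati_residual_has_derivative[OF has_derivative_ident D] by (simp add: pA F'[unfolded F] F lyapunov_def)
    moreover have zero: "\<forall>\<^sub>F X in nhds A. 0 = ?ric X (p X)"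
      using evV by eventually_elim (use ric_p in auto)
    have "((\<lambda>X. ?ric X (p X)) has_derivative (\<lambda>H. 0)) (at A)"
      by (rule has_derivative_transform_eventually[OF has_derivative_const
            filter_leD[OF at_within_le_nhds zero] eventually_nhds_x_imp_x[OF zero] UNIV_I])
    ultimately have "(\<lambda>H. - (P ** H + transpose H ** P) - lyapunov F (D H)) = (\<lambda>H. 0)"
      by (rule has_derivative_unique)
    from fun_cong[OF this, of H] show ?thesis by simp
  qed
  ultimately show ?thesis by (rule that)
qed

section \<open>Blocks as two-sided projections\<close>

text \<open>
  Multiplying by these coordinate projections cuts blocks out of full-size matrices:
  \<open>block_proj p i ** X ** block_proj q j\<close> is \<open>X\<close> with all entries outside the block \<open>(i, j)\<close> set
  to zero. Block diagonal matrices commute with these projections, and in this form the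
  arguments about blocks become matrix algebra without block sizes.
\<close>

definition block_proj :: "'a bpart \<Rightarrow> nat \<Rightarrow> real ^ 'a ^ 'a" where
  "block_proj p i = (\<chi> x y. if x = y \<and> x \<in> bidx p i ` {..<bsize p i} then 1 else 0)"

lemma block_proj_mult_left:
  fixes X :: "real ^ 'c ^ 'r"
  shows "(block_proj p i ** X) $ x $ y = (if x \<in> bidx p i ` {..<bsize p i} then X $ x $ y else 0)"
proof -
  have "(block_proj p i ** X) $ x $ y
      = (\<Sum>z\<in>UNIV. if z = x then (if x \<in> bidx p i ` {..<bsize p i} then X $ x $ y else 0) else 0)"
    unfolding matrix_matrix_mult_def block_proj_def vec_lambda_beta
    by (intro sum.cong) auto
  thus ?thesis by (simp only: sum.delta[OF finite] UNIV_I if_True)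
qed

lemma block_proj_mult_right:
  fixes X :: "real ^ 'c ^ 'r"
  shows "(X ** block_proj p i) $ x $ y = (if y \<in> bidx p i ` {..<bsize p i} then X $ x $ y else 0)"
proof -
  have "(X ** block_proj p i) $ x $ y
      = (\<Sum>z\<in>UNIV. if z = y then (if y \<in> bidx p i ` {..<bsize p i} then X $ x $ y else 0) else 0)"
    unfolding matrix_matrix_mult_def block_proj_def vec_lambda_beta
    by (intro sum.cong) auto
  thus ?thesis by (simp only: sum.delta[OF finite] UNIV_I if_True)
qed

lemma transpose_block_proj: "transpose (block_proj p i) = block_proj p i"
  by (auto simp: transpose_def block_proj_def Finite_Cartesian_Product.vec_eq_iff)

lemma block_proj_idem: "block_proj p i ** block_proj p i = block_proj p i"
  by (simp add: Finite_Cartesian_Product.vec_eq_iff block_proj_mult_left)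
    (simp add: block_proj_def)

lemma partition_into_inj:
  assumes "partition_into k p" "i \<in> {1..k}"
  shows "inj_on (bidx p i) {..<bsize p i}"
proof (rule inj_onI)
  fix a b assume "a \<in> {..<bsize p i}" "b \<in> {..<bsize p i}" "bidx p i a = bidx p i b"
  thus "a = b"
    using assms inj_onD[of "\<lambda>(i, a). bidx p i a" "SIGMA i:{1..k}. {..<bsize p i}" "(i, a)" "(i, b)"]
    by (auto simp: partition_into_def bij_betw_def)
qed

lemma partition_into_unique_block:
  assumes "partition_into k p" "i \<in> {1..k}" "j \<in> {1..k}" "a < bsize p i" "b < bsize p j"
    "bidx p i a = bidx p j b"
  shows "i = j"
  using assms inj_onD[of "\<lambda>(i, a). bidx p i a" "SIGMA i:{1..k}. {..<bsize p i}" "(i, a)" "(j, b)"]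
  by (auto simp: partition_into_def bij_betw_def)

lemma partition_into_cover:
  assumes "partition_into k p"
  obtains i a where "i \<in> {1..k}" "a < bsize p i" "x = bidx p i a"
proof -
  have "x \<in> (\<lambda>(i, a). bidx p i a) ` (SIGMA i:{1..k}. {..<bsize p i})"
    using assms by (simp add: partition_into_def bij_betw_def)
  thus ?thesis using that by auto
qed

lemma block_diagonal_commute:
  fixes X :: "real ^ 'c ^ 'r"
  assumes p: "partition_into k p" and q: "partition_into k q"
    and X: "block_diagonal k p q X" and i: "i \<in> {1..k}"
  shows "block_proj p i ** X = X ** block_proj q i"
proof -
  have "X $ x $ y = 0"
    if "(x \<in> bidx p i ` {..<bsize p i}) \<noteq> (y \<in> bidx q i ` {..<bsize q i})" for x y
  proof -
    obtain l a where l: "l \<in> {1..k}" "a < bsize p l" "x = bidx p l a"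
      by (rule partition_into_cover[OF p])
    obtain m b where m: "m \<in> {1..k}" "b < bsize q m" "y = bidx q m b"
      by (rule partition_into_cover[OF q])
    have "x \<in> bidx p i ` {..<bsize p i} \<longleftrightarrow> l = i"
      using partition_into_unique_block[OF p i l(1) _ l(2)] l by (metis image_iff lessThan_iff)
    moreover have "y \<in> bidx q i ` {..<bsize q i} \<longleftrightarrow> m = i"
      using partition_into_unique_block[OF q i m(1) _ m(2)] m by (metis image_iff lessThan_iff)
    ultimately have "l \<noteq> m" using that by auto
    hence "block p q X l m = 0\<^sub>m (bsize p l) (bsize q m)"
      using X l(1) m(1) by (simp add: block_diagonal_def)
    from arg_cong[OF this, of "\<lambda>M. M $$ (a, b)"] show ?thesis
      using l m by (simp add: block_def)
  qed
  thus ?thesis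
    by (auto simp: Finite_Cartesian_Product.vec_eq_iff block_proj_mult_left block_proj_mult_right)
qed

lemma frob_norm_block:
  fixes X :: "real ^ 'c ^ 'r"
  assumes p: "partition_into k p" and q: "partition_into k q" and i: "i \<in> {1..k}" and j: "j \<in> {1..k}"
  shows "frob_norm (block p q X i j) = norm (block_proj p i ** X ** block_proj q j)"
proof -
  let ?I = "bidx p i ` {..<bsize p i}" and ?J = "bidx q j ` {..<bsize q j}"
  let ?Z = "block_proj p i ** X ** block_proj q j"
  have Z: "?Z $ x $ y = (if y \<in> ?J then if x \<in> ?I then X $ x $ y else 0 else 0)" for x y
    by (simp only: block_proj_mult_left block_proj_mult_right)
  have "?Z \<bullet> ?Z = (\<Sum>x\<in>UNIV. \<Sum>y\<in>UNIV. (?Z $ x $ y)\<^sup>2)"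
    by (simp add: inner_vec_def power2_eq_square)
  also have "\<dots> = (\<Sum>x\<in>?I. \<Sum>y\<in>UNIV. (?Z $ x $ y)\<^sup>2)"
    by (rule sum.mono_neutral_right) (auto simp: Z intro!: sum.neutral)
  also have "\<dots> = (\<Sum>x\<in>?I. \<Sum>y\<in>?J. (?Z $ x $ y)\<^sup>2)"
    by (intro sum.cong refl sum.mono_neutral_right) (auto simp: Z)
  also have "\<dots> = (\<Sum>x\<in>?I. \<Sum>y\<in>?J. (X $ x $ y)\<^sup>2)"
    by (intro sum.cong refl) (auto simp: Z)
  also have "\<dots> = (\<Sum>a<bsize p i. \<Sum>b<bsize q j. (X $ bidx p i a $ bidx q j b)\<^sup>2)"
    by (simp add: sum.reindex[OF partition_into_inj[OF p i]] sum.reindex[OF partition_into_inj[OF q j]])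
  finally show ?thesis
    by (simp add: frob_norm_def block_def norm_eq_sqrt_inner)
qed

section \<open>The Riccati solution inherits the block structure\<close>

lemma matrix_inv_commute:
  fixes M :: "real ^ 'n ^ 'n"
  assumes M: "invertible M" and comm: "M ** J = J ** M"
  shows "matrix_inv M ** J = J ** matrix_inv M"
proof -
  have "matrix_inv M ** J = matrix_inv M ** (J ** M) ** matrix_inv M"
    by (simp only: matrix_mul_assoc[symmetric] matrix_inv_inverse[OF M] matrix_mul_rid)
  also have "\<dots> = J ** matrix_inv M"
    by (simp only: comm[symmetric] matrix_mul_assoc matrix_inv_inverse[OF M] matrix_mul_lid)
  finally show ?thesis .
qed

lemma riccati_coeff_commute:
  fixes B :: "real ^ 'm ^ 'n"
  assumes R: "sym_pos_def R" and symJ: "transpose J = J" and symJ': "transpose J' = J'"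
    and B: "J ** B = B ** J'" and comm: "J' ** R = R ** J'"
  shows "J ** riccati_coeff B R = riccati_coeff B R ** J"
proof -
  have BT: "transpose B ** J = J' ** transpose B"
    using arg_cong[OF B, of transpose] by (simp only: matrix_transpose_mul symJ symJ')
  have inv: "matrix_inv R ** J' = J' ** matrix_inv R"
    by (rule matrix_inv_commute[OF sym_pos_def_invertible[OF R] comm[symmetric]])
  have "riccati_coeff B R ** J = B ** (matrix_inv R ** (transpose B ** J))"
    by (simp only: riccati_coeff_def matrix_mul_assoc)
  also have "\<dots> = B ** (matrix_inv R ** J') ** transpose B"
    by (simp only: BT matrix_mul_assoc)
  also have "\<dots> = J ** riccati_coeff B R"
    by (simp only: inv B[symmetric] riccati_coeff_def matrix_mul_assoc)
  finally show ?thesis by simp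
qed

text \<open>
  An orthogonal involution \<open>J\<close> that preserves the coefficients of the Riccati equation maps its
  symmetric positive definite solutions \<open>P\<close> to solutions \<open>J P J\<close> of the same kind. There is only one.
\<close>

lemma riccati_sol_commute_involution:
  fixes A J :: "real ^ 'n ^ 'n" and B :: "real ^ 'm ^ 'n"
  assumes uniq: "\<exists>!P. sym_pos_def P \<and> riccati B Q R A P"
    and symJ: "transpose J = J" and JJ: "J ** J = mat 1"
    and A: "J ** A = A ** J" and Q: "J ** Q = Q ** J"
    and S: "J ** riccati_coeff B R = riccati_coeff B R ** J"
  shows "J ** riccati_sol B Q R A = riccati_sol B Q R A ** J"
proof -
  let ?P = "riccati_sol B Q R A" and ?S = "riccati_coeff B R"
  have P: "sym_pos_def ?P" "riccati_residual ?S Q A ?P = 0"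
    using theI'[OF uniq] by (simp_all add: riccati_sol_def riccati_iff_residual)
  have AT: "J ** transpose A = transpose A ** J"
    using arg_cong[OF A, of transpose] by (simp only: matrix_transpose_mul symJ)
  have JJX: "J ** (J ** X) = X" for X :: "real ^ 'n ^ 'n"
    by (simp only: matrix_mul_assoc JJ matrix_mul_lid)
  have "riccati_residual ?S Q A (J ** ?P ** J) = J ** riccati_residual ?S Q A ?P ** J"
  proof -
    have 1: "J ** ?P ** J ** ?S ** (J ** ?P ** J) = J ** (?P ** ?S ** ?P) ** J"
      by (metis JJX S matrix_mul_assoc)
    have 2: "J ** ?P ** J ** A = J ** (?P ** A) ** J"
      by (metis A matrix_mul_assoc)
    have 3: "transpose A ** (J ** ?P ** J) = J ** (transpose A ** ?P) ** J"
      by (metis AT matrix_mul_assoc)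
    have 4: "J ** Q ** J = Q"
      by (simp only: Q matrix_mul_assoc[symmetric] JJ matrix_mul_rid)
    show ?thesis
      by (simp only: riccati_residual_def 1 2 3 4 matrix_mult.diff_left matrix_mult.diff_right)
  qed
  hence "riccati B Q R A (J ** ?P ** J)"
    by (simp only: riccati_iff_residual P matrix_mult.zero_left matrix_mult.zero_right)
  moreover have "sym_pos_def (J ** ?P ** J)"
    unfolding sym_pos_def_def
  proof (intro conjI allI impI)
    show "transpose (J ** ?P ** J) = J ** ?P ** J"
      using P(1) by (simp only: matrix_transpose_mul symJ sym_pos_def_def matrix_mul_assoc)
    fix x :: "real ^ 'n" assume "x \<noteq> 0"
    moreover have "J *v (J *v x) = x"
      by (simp only: matrix_vector_mul_assoc JJ matrix_vector_mul_lid)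
    ultimately have "J *v x \<noteq> 0" by auto
    hence "0 < (J *v x) \<bullet> (?P *v (J *v x))"
      using P(1) by (simp add: sym_pos_def_def)
    also have "\<dots> = x \<bullet> ((J ** ?P ** J) *v x)"
      using inner_matrix_vector_mult[of x J "?P *v (J *v x)"]
      by (simp only: symJ matrix_vector_mul_assoc matrix_mul_assoc)
    finally show "0 < x \<bullet> ((J ** ?P ** J) *v x)" .
  qed
  ultimately have "J ** ?P ** J = ?P"
    using uniq theI'[OF uniq, folded riccati_sol_def] by blast
  thus ?thesis by (metis JJX matrix_mul_assoc)
qed

text \<open>
  For an orthogonal projection \<open>E\<close> the reflection \<open>1 - 2 E\<close>, which flips the signs of the coordinates in
  one block when \<open>E\<close> is a block projection, is an orthogonal involution. It commutes with the same
  matrices as \<open>E\<close>. The matrix \<open>E'\<close> plays the corresponding role on the input side.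
\<close>

lemma riccati_sol_commute_projection:
  fixes A E :: "real ^ 'n ^ 'n" and B :: "real ^ 'm ^ 'n"
  assumes uniq: "\<exists>!P. sym_pos_def P \<and> riccati B Q R A P" and R: "sym_pos_def R"
    and E: "transpose E = E" "E ** E = E" and E': "transpose E' = E'"
    and A: "E ** A = A ** E" and Q: "E ** Q = Q ** E" and B: "E ** B = B ** E'" and R': "E' ** R = R ** E'"
  shows "E ** riccati_sol B Q R A = riccati_sol B Q R A ** E"
    and "E ** closed_loop B Q R A = closed_loop B Q R A ** E"
proof -
  let ?S = "riccati_coeff B R" and ?P = "riccati_sol B Q R A"
  let ?J = "mat 1 - (E + E)"
  have S: "E ** ?S = ?S ** E"
    by (rule riccati_coeff_commute[OF R E(1) E' B R'])
  have comm: "?J ** X = X ** ?J \<longleftrightarrow> E ** X = X ** E" for X :: "real ^ 'n ^ 'n"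
  proof -
    have "?J ** X = X - 2 *\<^sub>R (E ** X)" "X ** ?J = X - 2 *\<^sub>R (X ** E)"
      by (simp_all only: matrix_mult.diff_left matrix_mult.diff_right matrix_mult.add_left
          matrix_mult.add_right matrix_mul_lid matrix_mul_rid scaleR_2)
    thus ?thesis by simp
  qed
  have "?J ** ?P = ?P ** ?J"
  proof (rule riccati_sol_commute_involution[OF uniq])
    show "transpose ?J = ?J"
      by (simp only: matrix_transpose_diff matrix_transpose_add E transpose_mat)
    show "?J ** ?J = mat 1"
      by (simp only: matrix_mult.diff_left matrix_mult.diff_right matrix_mult.add_left
          matrix_mult.add_right E matrix_mul_lid matrix_mul_rid) simp
  qed (simp_all only: comm A Q S)
  thus P: "E ** ?P = ?P ** E" by (simp only: comm)
  have cl: "closed_loop B Q R A = A - ?S ** ?P"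
    by (simp only: closed_loop_def riccati_coeff_def)
  have "E ** (?S ** ?P) = ?S ** ?P ** E"
    by (metis P S matrix_mul_assoc)
  thus "E ** closed_loop B Q R A = closed_loop B Q R A ** E"
    by (simp only: cl matrix_mult.diff_left matrix_mult.diff_right A)
qed

section \<open>The smallest singular value of an operator on an invariant subspace\<close>

text \<open>
  Let \<open>w\<close> minimise \<open>norm (L w)\<close> on the unit sphere of the range of the orthogonal projection \<open>\<pi>\<close>, which
  \<open>L\<close> and its adjoint \<open>L'\<close> leave invariant. The minimum \<open>s\<close> is positive, and \<open>w\<close> is an
  eigenvector of \<open>L' L\<close> for \<open>s\<^sup>2\<close>. Then \<open>L w\<close> is an eigenvector of \<open>L L'\<close> for the same eigenvalue,
  so that the least element of the set is at most \<open>s\<close>. It is not zero, because \<open>L\<close> is onto, whence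
  \<open>L'\<close> is injective.
  The set is formed with \<open>L L'\<close> rather than \<open>L' L\<close> because the matrix in the definition of
  \<^const>\<open>sep\<close> turns out to represent the adjoint of the Lyapunov operator.
\<close>

lemma smallest_singular_value:
  fixes L L' \<pi> :: "'a::euclidean_space \<Rightarrow> 'a"
  assumes linL: "linear L" and linL': "linear L'" and adj: "\<And>x y. L x \<bullet> y = x \<bullet> L' y" and inj: "inj L"
    and lin\<pi>: "linear \<pi>" and sym\<pi>: "\<And>x y. \<pi> x \<bullet> y = x \<bullet> \<pi> y" and idem: "\<And>x. \<pi> (\<pi> x) = \<pi> x"
    and L\<pi>: "\<And>x. L (\<pi> x) = \<pi> (L x)" and L'\<pi>: "\<And>x. L' (\<pi> x) = \<pi> (L' x)"
    and nontriv: "\<pi> u \<noteq> 0"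
    and fin: "finite {s. 0 \<le> s \<and> (\<exists>v. v \<noteq> 0 \<and> \<pi> v = v \<and> L (L' v) = s\<^sup>2 *\<^sub>R v)}" (is "finite ?S")
  shows "0 < Min ?S" and "\<pi> v = v \<Longrightarrow> Min ?S * norm v \<le> norm (L v)"
proof -
  let ?V = "sphere 0 1 \<inter> range \<pi>"
  have range: "w \<in> range \<pi> \<longleftrightarrow> \<pi> w = w" for w
    by (metis idem rangeE rangeI)
  have "subspace (range \<pi>)"
    using lin\<pi> by (intro linear_subspace_image subspace_UNIV)
  hence "compact ?V"
    by (intro compact_Int_closed compact_sphere closed_subspace)
  moreover have "\<pi> u /\<^sub>R norm (\<pi> u) \<in> ?V"
    using nontriv by (auto simp: range linear_scale[OF lin\<pi>] idem)
  hence "?V \<noteq> {}" by blast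
  moreover have "continuous_on ?V (\<lambda>w. norm (L w))"
    using linL by (intro continuous_intros linear_continuous_on) (simp add: linear_conv_bounded_linear)
  ultimately obtain w where "w \<in> ?V" and w_min: "\<And>v. v \<in> ?V \<Longrightarrow> norm (L w) \<le> norm (L v)"
    using continuous_attains_inf[of ?V "\<lambda>w. norm (L w)"] by blast
  hence w: "norm w = 1" "\<pi> w = w" "w \<noteq> 0" by (auto simp: range)
  define s where "s = norm (L w)"
  have le: "s * norm v \<le> norm (L v)" if v: "\<pi> v = v" for v
  proof (cases "v = 0")
    case False
    have "v /\<^sub>R norm v \<in> ?V"
      using False v by (auto simp: range linear_scale[OF lin\<pi>])
    from w_min[OF this] show ?thesis
      using False by (simp add: s_def linear_scale[OF linL] field_simps)
  qed simp
  define T where "T v = L' (L (\<pi> v)) - s\<^sup>2 *\<^sub>R \<pi> v" for v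
  have adj': "x \<bullet> L y = L' x \<bullet> y" for x y
    by (metis adj inner_commute)
  have "T w = 0"
  proof (rule semidefinite_null_vector[where T = T and v = w])
    show "linear T"
      unfolding T_def
      using linear_compose[OF linear_compose[OF lin\<pi> linL] linL'] lin\<pi>
      by (intro linear_compose_sub linear_compose_scale_right) (simp_all add: o_def)
    show "T v \<bullet> x = v \<bullet> T x" for v x
    proof -
      have "L' (L (\<pi> v)) \<bullet> x = L (\<pi> v) \<bullet> L x" "v \<bullet> L' (L (\<pi> x)) = L v \<bullet> L (\<pi> x)"
        by (rule adj'[symmetric], rule adj[symmetric])
      moreover have "L (\<pi> v) \<bullet> L x = L v \<bullet> L (\<pi> x)"
        by (simp only: L\<pi> sym\<pi>)
      ultimately show ?thesis
        by (simp add: T_def inner_diff_left inner_diff_right sym\<pi>)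
    qed
    have form: "v \<bullet> T v = (norm (L (\<pi> v)))\<^sup>2 - (s * norm (\<pi> v))\<^sup>2" for v
    proof -
      have "v \<bullet> L' (L (\<pi> v)) = L v \<bullet> \<pi> (L (\<pi> v))"
        by (simp only: adj L\<pi>[symmetric] idem)
      also have "\<dots> = (norm (L (\<pi> v)))\<^sup>2"
        by (simp only: sym\<pi>[symmetric] L\<pi> idem power2_norm_eq_inner)
      finally have "v \<bullet> L' (L (\<pi> v)) = (norm (L (\<pi> v)))\<^sup>2" .
      moreover have "v \<bullet> \<pi> v = (norm (\<pi> v))\<^sup>2"
        by (metis idem power2_norm_eq_inner sym\<pi>)
      ultimately show ?thesis
        by (simp add: T_def inner_diff_right power_mult_distrib)
    qed
    show "0 \<le> v \<bullet> T v" for v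
      using power_mono[OF le[of "\<pi> v"], of 2] by (simp add: form idem s_def)
    show "w \<bullet> T w = 0"
      by (simp add: form w s_def)
  qed
  hence "L' (L w) = s\<^sup>2 *\<^sub>R w" by (simp add: T_def w)
  hence eig: "L (L' (L w)) = s\<^sup>2 *\<^sub>R L w" by (simp add: linear_scale[OF linL])
  have "L w \<noteq> 0"
    using inj w(3) linear_injective_0[OF linL] by blast
  moreover have "\<pi> (L w) = L w" by (metis L\<pi> w(2))
  ultimately have "s \<in> ?S" using eig by (auto simp: s_def)
  hence Min_le: "Min ?S \<le> s"
    by (rule Min_le[OF fin])
  have "Min ?S \<in> ?S"
    using \<open>s \<in> ?S\<close> by (intro Min_in[OF fin]) blast
  then obtain z where z: "0 \<le> Min ?S" "z \<noteq> 0" "L (L' z) = (Min ?S)\<^sup>2 *\<^sub>R z" by blast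
  show "Min ?S * norm v \<le> norm (L v)" if "\<pi> v = v"
    using le[OF that] mult_right_mono[OF Min_le norm_ge_zero[of v]] by linarith
  have "Min ?S \<noteq> 0"
  proof
    assume "Min ?S = 0"
    hence "L (L' z) \<bullet> z = 0" using z by simp
    hence "L' z = 0" by (simp add: adj)
    moreover obtain y where "z = L y"
      using linear_injective_imp_surjective[OF linL inj] by (metis surjD)
    ultimately have "z \<bullet> z = 0" using adj[of y z] by simp
    thus False using z by simp
  qed
  thus "0 < Min ?S" using z by simp
qed

section \<open>The Kronecker matrix of the separation\<close>

definition sep_matrix :: "real mat \<Rightarrow> real mat \<Rightarrow> real mat" where
  "sep_matrix X Y = kronecker (1\<^sub>m (dim_row Y)) X - kronecker (transpose_mat Y) (1\<^sub>m (dim_row X))"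

abbreviation block_sep_matrix :: "'a::finite bpart \<Rightarrow> real ^ 'a ^ 'a \<Rightarrow> nat \<Rightarrow> nat \<Rightarrow> real mat" where
  "block_sep_matrix p F i j \<equiv> sep_matrix (block p p F j j) (- transpose_mat (block p p F i i))"

text \<open>
  Row-wise vectorisation of the block \<open>(i, j)\<close>: row \<open>a\<close> and column \<open>b\<close> of the block go to position
  \<open>a * bsize p j + b\<close>. With this order the first Kronecker factor acts on the row index.
\<close>

definition flat_block :: "'a::finite bpart \<Rightarrow> nat \<Rightarrow> nat \<Rightarrow> real ^ 'a ^ 'a \<Rightarrow> real Matrix.vec" where
  "flat_block p i j Z = Matrix.vec (bsize p i * bsize p j)
     (\<lambda>r. Z $ bidx p i (r div bsize p j) $ bidx p j (r mod bsize p j))"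

lemma div_mod_bounds:
  fixes m n r :: nat
  assumes "r < m * n"
  shows "r div n < m" "r mod n < n"
  using assms by (auto simp: less_mult_imp_div_less intro!: mod_less_divisor gr0I)

lemma sum_div_mod:
  fixes f :: "nat \<Rightarrow> nat \<Rightarrow> 'b::comm_monoid_add"
  shows "(\<Sum>s<m * n. f (s div n) (s mod n)) = (\<Sum>a<m. \<Sum>b<n. f a b)"
proof -
  have "(\<Sum>s<m * n. f (s div n) (s mod n)) = (\<Sum>(a, b)\<in>{..<m} \<times> {..<n}. f a b)"
  proof (rule sum.reindex_bij_witness[where j = "\<lambda>s. (s div n, s mod n)" and i = "\<lambda>(a, b). a * n + b"])
    fix ab assume "ab \<in> {..<m} \<times> {..<n}"
    then obtain a b where ab: "ab = (a, b)" "a < m" "b < n" by auto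
    have "a * n + b < (a + 1) * n" using ab by simp
    also have "\<dots> \<le> m * n" using ab by (intro mult_le_mono1) simp
    finally show "(case ab of (a, b) \<Rightarrow> a * n + b) \<in> {..<m * n}" by (simp add: ab)
  qed (auto simp: div_mod_bounds)
  thus ?thesis by (simp add: sum.cartesian_product)
qed

lemma dim_block_sep_matrix [simp]:
  "dim_row (block_sep_matrix p F i j) = bsize p i * bsize p j"
  "dim_col (block_sep_matrix p F i j) = bsize p i * bsize p j"
  by (simp_all add: sep_matrix_def kronecker_def block_def)

lemma block_sep_matrix_index:
  assumes "r < bsize p i * bsize p j" "s < bsize p i * bsize p j"
  shows "block_sep_matrix p F i j $$ (r, s) =
    (if r div bsize p j = s div bsize p j
     then F $ bidx p j (r mod bsize p j) $ bidx p j (s mod bsize p j) else 0)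
    + (if r mod bsize p j = s mod bsize p j
     then F $ bidx p i (r div bsize p j) $ bidx p i (s div bsize p j) else 0)"
  using assms div_mod_bounds[OF assms(1)] div_mod_bounds[OF assms(2)]
  by (simp add: sep_matrix_def kronecker_def block_def)

lemma transpose_block_sep_matrix:
  "transpose_mat (block_sep_matrix p F i j) = block_sep_matrix p (transpose F) i j"
  by (rule eq_matI) (auto simp: block_sep_matrix_index transpose_def)

text \<open>
  The rows of block \<open>j\<close> of a matrix that commutes with the projection have their nonzero entries
  in the columns of block \<open>j\<close>, which turns full-size row sums into sums over one block.
\<close>

lemma block_row_sum:
  fixes F :: "real ^ 'a ^ 'a"
  assumes p: "partition_into k p" and j: "j \<in> {1..k}"
    and comm: "block_proj p j ** F = F ** block_proj p j" and b: "b < bsize p j"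
  shows "(\<Sum>y\<in>UNIV. F $ bidx p j b $ y * g y) = (\<Sum>c<bsize p j. F $ bidx p j b $ bidx p j c * g (bidx p j c))"
proof -
  have "F $ bidx p j b $ y = 0" if "y \<notin> bidx p j ` {..<bsize p j}" for y
    using arg_cong[OF comm, of "\<lambda>M. M $ bidx p j b $ y"] that b
    by (simp add: block_proj_mult_left block_proj_mult_right split: if_splits)
  hence "(\<Sum>y\<in>UNIV. F $ bidx p j b $ y * g y) = (\<Sum>y\<in>bidx p j ` {..<bsize p j}. F $ bidx p j b $ y * g y)"
    by (intro sum.mono_neutral_right) auto
  thus ?thesis by (simp add: sum.reindex[OF partition_into_inj[OF p j]])
qed

text \<open>
  In vectorised form the matrix whose singular values define the separation of \<open>F\<^sub>j\<^sub>j\<close> and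
  \<open>- F\<^sub>i\<^sub>i\<^sup>T\<close> is the block \<open>(i, j)\<close> of \<open>Z \<mapsto> Z F\<^sup>T + F Z\<close>. This is the Lyapunov operator of \<open>F\<^sup>T\<close>,
  the adjoint of that of \<open>F\<close>.
\<close>

lemma block_sep_matrix_flat:
  fixes F Z :: "real ^ 'a ^ 'a"
  assumes p: "partition_into k p" and i: "i \<in> {1..k}" and j: "j \<in> {1..k}"
    and Fi: "block_proj p i ** F = F ** block_proj p i" and Fj: "block_proj p j ** F = F ** block_proj p j"
  shows "block_sep_matrix p F i j *\<^sub>v flat_block p i j Z = flat_block p i j (Z ** transpose F + F ** Z)"
proof (rule eq_vecI)
  let ?ni = "bsize p i" and ?nj = "bsize p j"
  show "dim_vec (block_sep_matrix p F i j *\<^sub>v flat_block p i j Z) = dim_vec (flat_block p i j (Z ** transpose F + F ** Z))"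
    by (simp add: flat_block_def)
  fix r assume "r < dim_vec (flat_block p i j (Z ** transpose F + F ** Z))"
  hence r: "r < ?ni * ?nj" by (simp add: flat_block_def)
  define a b where "a = r div ?nj" and "b = r mod ?nj"
  have ab: "a < ?ni" "b < ?nj" using div_mod_bounds[OF r] by (simp_all add: a_def b_def)
  have if_mult: "(if c then x else 0) * y = (if c then x * y else 0)" for c and x y :: real
    by simp
  have "Matrix.vec_index (block_sep_matrix p F i j *\<^sub>v flat_block p i j Z) r
    = (\<Sum>s<?ni * ?nj. block_sep_matrix p F i j $$ (r, s) * Matrix.vec_index (flat_block p i j Z) s)"
    using r by (simp add: scalar_prod_def flat_block_def lessThan_atLeast0)
  also have "\<dots> = (\<Sum>s<?ni * ?nj. (\<lambda>a' b'.
      ((if a = a' then F $ bidx p j b $ bidx p j b' else 0)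
       + (if b = b' then F $ bidx p i a $ bidx p i a' else 0))
      * Z $ bidx p i a' $ bidx p j b') (s div ?nj) (s mod ?nj))"
    by (intro sum.cong refl) (simp only: block_sep_matrix_index[OF r] lessThan_iff a_def b_def,
      simp add: flat_block_def)
  also have "\<dots> = (\<Sum>a'<?ni. \<Sum>b'<?nj.
      ((if a = a' then F $ bidx p j b $ bidx p j b' else 0)
       + (if b = b' then F $ bidx p i a $ bidx p i a' else 0))
      * Z $ bidx p i a' $ bidx p j b')"
    by (rule sum_div_mod)
  also have "\<dots> = (\<Sum>a'<?ni. if a = a' then \<Sum>b'<?nj. F $ bidx p j b $ bidx p j b' * Z $ bidx p i a' $ bidx p j b' else 0)
      + (\<Sum>a'<?ni. \<Sum>b'<?nj. if b = b' then F $ bidx p i a $ bidx p i a' * Z $ bidx p i a' $ bidx p j b' else 0)"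
    unfolding distrib_right if_mult sum.distrib
    by (intro arg_cong2[where f = "(+)"] sum.cong refl) auto
  also have "\<dots> = (\<Sum>b'<?nj. F $ bidx p j b $ bidx p j b' * Z $ bidx p i a $ bidx p j b')
      + (\<Sum>a'<?ni. F $ bidx p i a $ bidx p i a' * Z $ bidx p i a' $ bidx p j b)"
    using ab by (simp add: sum.delta')
  also have "\<dots> = (\<Sum>y\<in>UNIV. F $ bidx p j b $ y * Z $ bidx p i a $ y)
      + (\<Sum>x\<in>UNIV. F $ bidx p i a $ x * Z $ x $ bidx p j b)"
    by (simp only: block_row_sum[OF p j Fj ab(2)] block_row_sum[OF p i Fi ab(1)])
  also have "\<dots> = Matrix.vec_index (flat_block p i j (Z ** transpose F + F ** Z)) r"
    using r by (simp add: flat_block_def a_def b_def matrix_matrix_mult_def transpose_def mult.commute)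
  finally show "Matrix.vec_index (block_sep_matrix p F i j *\<^sub>v flat_block p i j Z) r
    = Matrix.vec_index (flat_block p i j (Z ** transpose F + F ** Z)) r" .
qed

lemma flat_block_eq_iff:
  fixes Y Z :: "real ^ 'a ^ 'a"
  shows "flat_block p i j Y = flat_block p i j Z \<longleftrightarrow>
    block_proj p i ** Y ** block_proj p j = block_proj p i ** Z ** block_proj p j" (is "?L \<longleftrightarrow> ?R")
proof
  let ?ni = "bsize p i" and ?nj = "bsize p j"
  assume L: ?L
  have "Y $ bidx p i a $ bidx p j b = Z $ bidx p i a $ bidx p j b" if ab: "a < ?ni" "b < ?nj" for a b
  proof -
    have "a * ?nj + b < (a + 1) * ?nj" using ab by simp
    also have "\<dots> \<le> ?ni * ?nj" using ab by (intro mult_le_mono1) simp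
    finally show ?thesis
      using arg_cong[OF L, of "\<lambda>v. Matrix.vec_index v (a * ?nj + b)"] ab by (simp add: flat_block_def)
  qed
  thus ?R
    by (auto simp: Finite_Cartesian_Product.vec_eq_iff block_proj_mult_left block_proj_mult_right)
next
  let ?ni = "bsize p i" and ?nj = "bsize p j"
  assume R: ?R
  have "Y $ bidx p i a $ bidx p j b = Z $ bidx p i a $ bidx p j b" if ab: "a < ?ni" "b < ?nj" for a b
    using arg_cong[OF R, of "\<lambda>M. M $ bidx p i a $ bidx p j b"] ab
    by (simp add: block_proj_mult_left block_proj_mult_right)
  thus ?L
    by (auto simp: flat_block_def div_mod_bounds intro!: eq_vecI)
qed

lemma flat_block_surj:
  assumes p: "partition_into k p" and i: "i \<in> {1..k}" and j: "j \<in> {1..k}"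
    and v: "v \<in> carrier_vec (bsize p i * bsize p j)"
  obtains Z :: "real ^ 'a ^ 'a" where "v = flat_block p i j Z" "block_proj p i ** Z ** block_proj p j = Z"
proof -
  let ?ni = "bsize p i" and ?nj = "bsize p j"
  define f where "f i = the_inv_into {..<bsize p i} (bidx p i)" for i
  have f: "f l (bidx p l a) = a" if "a < bsize p l" "l \<in> {1..k}" for l a
    unfolding f_def using that by (intro the_inv_into_f_f partition_into_inj[OF p]) auto
  \<comment> \<open>Outside the block the entries of \<open>Y\<close> are arbitrary; the projection to \<open>Z\<close> removes them.\<close>
  define Y :: "real ^ 'a ^ 'a" where "Y = (\<chi> x y. Matrix.vec_index v (f i x * ?nj + f j y))"
  have Y: "v = flat_block p i j Y"
    using v by (intro eq_vecI) (auto simp: flat_block_def Y_def f[OF _ i] f[OF _ j] div_mod_bounds div_mult_mod_eq)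
  define Z where "Z = block_proj p i ** Y ** block_proj p j"
  have Z: "block_proj p i ** Z ** block_proj p j = Z"
    unfolding Z_def by (metis block_proj_idem matrix_mul_assoc)
  hence "flat_block p i j Z = flat_block p i j Y"
    unfolding flat_block_eq_iff by (simp only: Z_def)
  with Y Z that show ?thesis by metis
qed

lemma finite_singular_values:
  assumes M: "M \<in> carrier_mat n n"
  shows "finite (singular_values M)"
proof -
  let ?G = "transpose_mat M * M"
  have G: "?G \<in> carrier_mat n n" using M by simp
  have "char_poly ?G \<noteq> 0"
    using degree_monic_char_poly[OF G] by auto
  hence "finite {x. poly (char_poly ?G) x = 0}"
    by (rule poly_roots_finite)
  hence "finite (sqrt ` {x. poly (char_poly ?G) x = 0})" by simp
  moreover have "singular_values M \<subseteq> sqrt ` {x. poly (char_poly ?G) x = 0}"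
    using eigenvalue_root_char_poly[OF G] unfolding singular_values_def
    by (auto intro!: image_eqI[where x = "s\<^sup>2" for s])
  ultimately show ?thesis by (rule rev_finite_subset)
qed

section \<open>The separation bounds the Lyapunov operator on a block\<close>

lemma linear_lyapunov: "linear (lyapunov F)"
  by (simp add: linear_iff lyapunov_def matrix_mult.add_left matrix_mult.add_right
      matrix_mult.scaleR_left matrix_mult.scaleR_right scaleR_add_right)

lemma lyapunov_adjoint: "lyapunov F X \<bullet> Y = X \<bullet> lyapunov (transpose F) Y"
  using inner_matrix_mult_right[of X F Y] inner_matrix_mult_left[of "transpose F" X Y]
  by (simp add: lyapunov_def inner_add_left inner_add_right)

lemma transpose_commute:
  fixes E F :: "real ^ 'n ^ 'n"
  assumes "transpose E = E" "E ** F = F ** E"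
  shows "E ** transpose F = transpose F ** E"
  using arg_cong[OF assms(2), of transpose] by (simp only: matrix_transpose_mul assms(1))

text \<open>
  With block projections: the Lyapunov operator of a block diagonal matrix acts on each block
  separately.
\<close>

lemma lyapunov_two_sided_mult:
  assumes E: "transpose E = E" "E ** F = F ** E" and E': "E' ** F = F ** E'"
  shows "lyapunov F (E ** X ** E') = E ** lyapunov F X ** E'"
proof -
  have "transpose F ** (E ** X ** E') = E ** (transpose F ** X) ** E'"
    by (simp only: matrix_mul_assoc transpose_commute[OF E])
  moreover have "E ** X ** E' ** F = E ** (X ** F) ** E'"
    by (simp only: matrix_mul_assoc[symmetric] E')
  ultimately show ?thesis
    by (simp only: lyapunov_def matrix_mult.add_left matrix_mult.add_right)
qed

text \<open>
  Vectorisation identifies the vectors with the matrices supported on the block \<open>(i, j)\<close>. It carries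
  the Kronecker matrix to the adjoint of the Lyapunov operator, and its transpose to the
  operator itself.
\<close>

lemma eigenvalue_block_sep_gram:
  fixes F :: "real ^ 'a ^ 'a"
  assumes p: "partition_into k p" and i: "i \<in> {1..k}" and j: "j \<in> {1..k}"
    and Fi: "block_proj p i ** F = F ** block_proj p i" and Fj: "block_proj p j ** F = F ** block_proj p j"
  shows "eigenvalue (transpose_mat (block_sep_matrix p F i j) * block_sep_matrix p F i j) c \<longleftrightarrow>
    (\<exists>Z. Z \<noteq> 0 \<and> block_proj p i ** Z ** block_proj p j = Z
       \<and> lyapunov F (lyapunov (transpose F) Z) = c *\<^sub>R Z)"
proof -
  let ?N = "bsize p i * bsize p j" and ?K = "block_sep_matrix p F i j" and ?flat = "flat_block p i j"
  let ?\<pi> = "\<lambda>Z. block_proj p i ** Z ** block_proj p j" and ?LL = "\<lambda>Z. lyapunov F (lyapunov (transpose F) Z)"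
  have K: "?K \<in> carrier_mat ?N ?N" by (intro carrier_matI) simp_all
  have flat_carrier: "?flat Z \<in> carrier_vec ?N" for Z by (simp add: flat_block_def)
  have GT: "(transpose_mat ?K * ?K) *\<^sub>v ?flat Z = ?flat (?LL Z)" for Z
  proof -
    have "(transpose_mat ?K * ?K) *\<^sub>v ?flat Z = transpose_mat ?K *\<^sub>v (?K *\<^sub>v ?flat Z)"
      using K flat_carrier by (intro assoc_mult_mat_vec) auto
    also have "?K *\<^sub>v ?flat Z = ?flat (lyapunov (transpose F) Z)"
      by (simp only: block_sep_matrix_flat[OF p i j Fi Fj] lyapunov_def Finite_Cartesian_Product.transpose_transpose)
    also have "transpose_mat ?K *\<^sub>v \<dots> = ?flat (?LL Z)"
      unfolding transpose_block_sep_matrix lyapunov_def[of F]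
      using block_sep_matrix_flat[OF p i j transpose_commute[OF transpose_block_proj Fi]
          transpose_commute[OF transpose_block_proj Fj]]
      by (simp only: Finite_Cartesian_Product.transpose_transpose)
    finally show ?thesis .
  qed
  have flat_scale: "c \<cdot>\<^sub>v ?flat Z = ?flat (c *\<^sub>R Z)" for Z
    by (rule eq_vecI) (simp_all add: flat_block_def)
  have "0\<^sub>v ?N = ?flat 0"
    by (rule eq_vecI) (simp_all add: flat_block_def)
  hence flat_zero: "?flat Z = 0\<^sub>v ?N \<longleftrightarrow> ?\<pi> Z = 0" for Z
    by (simp only: flat_block_eq_iff matrix_mult.zero_left matrix_mult.zero_right)
  have LL: "?\<pi> (?LL Z) = ?LL (?\<pi> Z)" for Z
    by (simp only: lyapunov_two_sided_mult transpose_block_proj Fi Fj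
        transpose_commute[OF transpose_block_proj Fi] transpose_commute[OF transpose_block_proj Fj])
  have eig: "(transpose_mat ?K * ?K) *\<^sub>v ?flat Z = c \<cdot>\<^sub>v ?flat Z \<longleftrightarrow> ?LL Z = c *\<^sub>R Z" if "?\<pi> Z = Z" for Z
    by (simp only: GT flat_scale flat_block_eq_iff LL that matrix_mult.scaleR_left matrix_mult.scaleR_right)
  have "eigenvalue (transpose_mat ?K * ?K) c \<longleftrightarrow>
     (\<exists>v\<in>carrier_vec ?N. v \<noteq> 0\<^sub>v ?N \<and> (transpose_mat ?K * ?K) *\<^sub>v v = c \<cdot>\<^sub>v v)"
    using K by (auto simp: eigenvalue_def eigenvector_def)
  also have "\<dots> \<longleftrightarrow> (\<exists>Z. ?\<pi> Z = Z \<and> ?flat Z \<noteq> 0\<^sub>v ?N \<and> (transpose_mat ?K * ?K) *\<^sub>v ?flat Z = c \<cdot>\<^sub>v ?flat Z)"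
    by (metis flat_block_surj[OF p i j] flat_carrier)
  also have "\<dots> \<longleftrightarrow> (\<exists>Z. Z \<noteq> 0 \<and> ?\<pi> Z = Z \<and> ?LL Z = c *\<^sub>R Z)"
    using eig by (auto simp: flat_zero)
  finally show ?thesis .
qed

text \<open>
  The separation is the smallest singular value of the Lyapunov operator on the matrices supported
  on the block \<open>(i, j)\<close>. Its positivity matters: division by zero yields zero, so for a
  vanishing separation the final estimate would say that the derivative is zero.
\<close>

theorem sep_block_bound:
  fixes F :: "real ^ 'a ^ 'a"
  assumes p: "partition_into k p" and i: "i \<in> {1..k}" and j: "j \<in> {1..k}"
    and size: "0 < bsize p i" "0 < bsize p j"
    and Fi: "block_proj p i ** F = F ** block_proj p i" and Fj: "block_proj p j ** F = F ** block_proj p j"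
    and inj: "\<And>X. lyapunov F X = 0 \<Longrightarrow> X = 0"
  defines "\<sigma> \<equiv> sep (block p p F j j) (- transpose_mat (block p p F i i))"
  shows "0 < \<sigma>"
    and "block_proj p i ** Z ** block_proj p j = Z \<Longrightarrow> \<sigma> * norm Z \<le> norm (lyapunov F Z)"
proof -
  let ?\<pi> = "\<lambda>Z. block_proj p i ** Z ** block_proj p j"
  let ?S = "{s. 0 \<le> s \<and> (\<exists>Z. Z \<noteq> 0 \<and> ?\<pi> Z = Z \<and> lyapunov F (lyapunov (transpose F) Z) = s\<^sup>2 *\<^sub>R Z)}"
  have S: "singular_values (block_sep_matrix p F i j) = ?S"
    by (simp only: singular_values_def eigenvalue_block_sep_gram[OF p i j Fi Fj])
  hence \<sigma>: "\<sigma> = Min ?S"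
    unfolding \<sigma>_def sep_def sep_matrix_def[symmetric] by simp
  have fin: "finite ?S"
    unfolding S[symmetric] by (intro finite_singular_values carrier_matI) simp_all
  have nontriv: "?\<pi> (\<chi> x y. 1) \<noteq> 0"
  proof
    assume "?\<pi> (\<chi> x y. 1) = 0"
    hence "?\<pi> (\<chi> x y. 1) $ bidx p i 0 $ bidx p j 0 = 0" by simp
    thus False using size by (simp add: block_proj_mult_left block_proj_mult_right split: if_splits)
  qed
  have lin\<pi>: "linear ?\<pi>"
    by (simp add: linear_iff matrix_mult.add_left matrix_mult.add_right matrix_mult.scaleR_left matrix_mult.scaleR_right)
  have sym\<pi>: "?\<pi> X \<bullet> Y = X \<bullet> ?\<pi> Y" for X Y
    using inner_matrix_mult_right[of "block_proj p i ** X" "block_proj p j" Y]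
      inner_matrix_mult_left[of "block_proj p i" X "Y ** block_proj p j"]
    by (simp only: transpose_block_proj matrix_mul_assoc)
  have idem: "?\<pi> (?\<pi> X) = ?\<pi> X" for X
    by (metis block_proj_idem matrix_mul_assoc)
  have inj': "inj (lyapunov F)"
    using inj linear_injective_0[OF linear_lyapunov] by blast
  note comm = lyapunov_two_sided_mult[OF transpose_block_proj Fi Fj]
    lyapunov_two_sided_mult[OF transpose_block_proj transpose_commute[OF transpose_block_proj Fi]
      transpose_commute[OF transpose_block_proj Fj]]
  note main = smallest_singular_value[OF linear_lyapunov linear_lyapunov lyapunov_adjoint inj'
      lin\<pi> sym\<pi> idem comm nontriv fin]
  show "0 < \<sigma>" unfolding \<sigma> by (rule main(1))
  show "\<sigma> * norm Z \<le> norm (lyapunov F Z)" if "?\<pi> Z = Z"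
    unfolding \<sigma> using that by (rule main(2))
qed

section \<open>The bound on the derivative\<close>

theorem lemma5:
  fixes A :: "real ^ 'n ^ 'n" and B :: "real ^ 'm ^ 'n"
    and Q :: "real ^ 'n ^ 'n" and R :: "real ^ 'm ^ 'm"
    and k :: nat and p :: "'n bpart" and q :: "'m bpart"
  assumes "2 \<le> k"
    and "partition_into k p" and "\<forall>i\<in>{1..k}. 0 < bsize p i"
    and "partition_into k q"
    and "block_diagonal k p p A" and "block_diagonal k p q B"
    and "block_diagonal k p p Q" and "block_diagonal k q q R"
    and "sym_pos_def Q" and "sym_pos_def R"
    and "\<forall>\<^sub>F X in nhds A. \<exists>!P. sym_pos_def P \<and> riccati B Q R X P"
  shows "riccati_sol B Q R differentiable (at A) \<and>
    (\<forall>\<delta>A. \<forall>i\<in>{1..k}. \<forall>j\<in>{1..k}.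
      frob_norm (block p p (frechet_derivative (riccati_sol B Q R) (at A) \<delta>A) i j)
      \<le> (frob_norm (block p p (riccati_sol B Q R A) i i)
            + frob_norm (block p p (riccati_sol B Q R A) j j))
          / sep (block p p (closed_loop B Q R A) j j)
                (- transpose_mat (block p p (closed_loop B Q R A) i i))
          * max (frob_norm (block p p \<delta>A i j)) (frob_norm (block p p \<delta>A j i)))"
proof -
  note p = assms(2) and q = assms(4) and Qpos = assms(9) and Rpos = assms(10)
  define P F where "P = riccati_sol B Q R A" and "F = closed_loop B Q R A"
  obtain D where D: "(riccati_sol B Q R has_derivative D) (at A)"
    and lyap: "\<And>H. lyapunov F (D H) = - (P ** H + transpose H ** P)"
    using riccati_sol_has_derivative[OF Qpos Rpos assms(11)] unfolding P_def F_def by blast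
  have frechet: "frechet_derivative (riccati_sol B Q R) (at A) = D"
    using frechet_derivative_at[OF D] by simp
  have uniq: "\<exists>!P. sym_pos_def P \<and> riccati B Q R A P"
    using assms(11) by (rule eventually_nhds_x_imp_x)
  have sol: "sym_pos_def P" "riccati_residual (riccati_coeff B R) Q A P = 0"
    using theI'[OF uniq] by (simp_all add: P_def riccati_sol_def riccati_iff_residual)
  have inj: "X = 0" if "lyapunov F X = 0" for X
    using lyapunov_closed_loop_injective[OF transpose_riccati_coeff[OF Rpos] riccati_coeff_nonneg[OF Rpos]
        Qpos sol, of X] that
    by (simp only: F_def closed_loop_def riccati_coeff_def P_def)
  have comm: "block_proj p i ** P = P ** block_proj p i" "block_proj p i ** F = F ** block_proj p i"
    if i: "i \<in> {1..k}" for i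
    unfolding P_def F_def
    by (rule riccati_sol_commute_projection[OF uniq Rpos transpose_block_proj block_proj_idem
          transpose_block_proj block_diagonal_commute[OF p p assms(5) i] block_diagonal_commute[OF p p assms(7) i]
          block_diagonal_commute[OF p q assms(6) i] block_diagonal_commute[OF q q assms(8) i]])+
  have bound: "frob_norm (block p p (D H) i j)
      \<le> (frob_norm (block p p P i i) + frob_norm (block p p P j j))
          / sep (block p p F j j) (- transpose_mat (block p p F i i))
          * max (frob_norm (block p p H i j)) (frob_norm (block p p H j i))"
    if i: "i \<in> {1..k}" and j: "j \<in> {1..k}" for H i j
  proof -
    let ?Ei = "block_proj p i" and ?Ej = "block_proj p j"
    define \<sigma> where "\<sigma> = sep (block p p F j j) (- transpose_mat (block p p F i i))"
    define Z where "Z = ?Ei ** D H ** ?Ej"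
    define h where "h = max (norm (?Ei ** H ** ?Ej)) (norm (?Ej ** H ** ?Ei))"
    have size: "0 < bsize p i" "0 < bsize p j" using assms(3) i j by auto
    have \<sigma>: "0 < \<sigma>" "\<And>Z. ?Ei ** Z ** ?Ej = Z \<Longrightarrow> \<sigma> * norm Z \<le> norm (lyapunov F Z)"
      unfolding \<sigma>_def using sep_block_bound[OF p i j size comm(2)[OF i] comm(2)[OF j] inj] by auto
    have "?Ei ** Z ** ?Ej = Z"
      unfolding Z_def by (metis block_proj_idem matrix_mul_assoc)
    hence "\<sigma> * norm Z \<le> norm (lyapunov F Z)" by (rule \<sigma>(2))
    also have "lyapunov F Z = ?Ei ** lyapunov F (D H) ** ?Ej"
      unfolding Z_def by (rule lyapunov_two_sided_mult[OF transpose_block_proj comm(2)[OF i] comm(2)[OF j]])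
    also have "\<dots> = - (?Ei ** P ** H ** ?Ej + ?Ei ** transpose H ** P ** ?Ej)"
      by (simp only: lyap matrix_mult.minus_left matrix_mult.minus_right matrix_mult.add_left
          matrix_mult.add_right matrix_mul_assoc)
    \<comment> \<open>Since \<open>P\<close> is block diagonal, only one block of each factor contributes.\<close>
    also have "?Ei ** P ** H ** ?Ej = (?Ei ** P ** ?Ei) ** (?Ei ** H ** ?Ej)"
      by (metis comm(1)[OF i] block_proj_idem matrix_mul_assoc)
    also have "?Ei ** transpose H ** P ** ?Ej = (?Ei ** transpose H ** ?Ej) ** (?Ej ** P ** ?Ej)"
      by (metis comm(1)[OF j] block_proj_idem matrix_mul_assoc)
    also have "?Ei ** transpose H ** ?Ej = transpose (?Ej ** H ** ?Ei)"
      by (simp only: matrix_transpose_mul transpose_block_proj matrix_mul_assoc)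
    also have "norm (- ((?Ei ** P ** ?Ei) ** (?Ei ** H ** ?Ej) + transpose (?Ej ** H ** ?Ei) ** (?Ej ** P ** ?Ej)))
      \<le> norm (?Ei ** P ** ?Ei) * norm (?Ei ** H ** ?Ej) + norm (transpose (?Ej ** H ** ?Ei)) * norm (?Ej ** P ** ?Ej)"
      unfolding norm_minus_cancel by (intro norm_triangle_le add_mono norm_matrix_mult_le)
    also have "\<dots> \<le> norm (?Ei ** P ** ?Ei) * h + h * norm (?Ej ** P ** ?Ej)"
      unfolding norm_transpose h_def by (intro add_mono mult_left_mono mult_right_mono) auto
    finally have "norm Z * \<sigma> \<le> (norm (?Ei ** P ** ?Ei) + norm (?Ej ** P ** ?Ej)) * h"
      by (simp add: algebra_simps)
    hence "norm Z \<le> (norm (?Ei ** P ** ?Ei) + norm (?Ej ** P ** ?Ej)) * h / \<sigma>"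
      using \<sigma>(1) by (simp only: pos_le_divide_eq)
    thus ?thesis
      by (simp only: frob_norm_block[OF p p i j] frob_norm_block[OF p p j i] frob_norm_block[OF p p i i]
          frob_norm_block[OF p p j j] Z_def[symmetric] h_def[symmetric] \<sigma>_def[symmetric]
          times_divide_eq_left)
  qed
  show ?thesis
    unfolding frechet P_def[symmetric] F_def[symmetric]
    using bound D by (auto simp: differentiable_def)
qed

end
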